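(* Let $X\in\{A,B\}$ and $\lambda\in\mathbb{P}^1=\mathbb{C}\cup\{\infty\}$. Then the automorphism group of the Lie algebra $\mathcal{W}_X(\lambda)$ is $$\mathrm{Aut}(\mathcal{W}_X(\lambda))\cong\begin{cases} \mathbb{C}^\infty\rtimes(\mathbb{Z}/2\mathbb{Z}\ltimes(\mathbb{C}\rtimes(\mathbb{C}^\times\times\mathbb{C}^\times))),&X=A,\ \lambda\in\{0,-1\},\\ \mathbb{C}_0^\infty\rtimes(\mathbb{Z}/2\mathbb{Z}\ltimes(\mathbb{C}^2\rtimes(\mathbb{C}^\times\times\mathbb{C}^\times))),&X=B,\ \lambda=0,\\ \mathbb{C}_0^\infty\rtimes(\mathbb{Z}/2\mathbb{Z}\ltimes(\mathbb{C}\rtimes(\mathbb{C}^\times\times\mathbb{C}^\times))),&X=B,\ \lambda=-1,\\ \mathbb{C}^\infty\rtimes(\mathbb{C}\rtimes(\mathbb{C}^\times\times\mathbb{C}^\times)),&X=A,\ \lambda\notin\{0,-1\},\\ \mathbb{C}_0^\infty\rtimes(\mathbb{C}\rtimes(\mathbb{C}^\times\times\mathbb{C}^\times)),&X=B,\ \lambda\notin\{0,-1\}, \end{cases}$$ where the group structures on these products of sets are as follows. For $k,\ell\in\mathbb{Z}/2\mathbb{Z}$, $a,b,c,d\in\mathbb{C}$, $\alpha,\beta,\xi,\zeta\in\mathbb{C}^\times$, and $(y_i),(z_i)$ in $\mathbb{C}^\infty$ (if $X=A$) or $\mathbb{C}_0^\infty$ (if $X=B$), writing $\varepsilon_1=(-1)^k$,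 $\varepsilon_2=(-1)^\ell$: for $\mathcal{W}_B(0)$: $((y_i),k,a,b,\alpha,\xi)\cdot((z_i),\ell,c,d,\beta,\zeta)=((y_i+\alpha^{\varepsilon_1i}\xi z_{\varepsilon_1i}),\,k+\ell,\,\varepsilon_2a+\xi c,\,b+\xi d,\,\alpha^{\varepsilon_2}\beta,\,\xi\zeta)$; for $\mathcal{W}_A(0)$ and $\mathcal{W}_B(-1)$: $((y_i),k,a,\alpha,\xi)\cdot((z_i),\ell,c,\beta,\zeta)=((y_i+\alpha^{\varepsilon_1i}\xi z_{\varepsilon_1i}),\,k+\ell,\,\varepsilon_2a+\xi c,\,\alpha^{\varepsilon_2}\beta,\,\xi\zeta)$; for $\mathcal{W}_A(-1)$: $((y_i),k,b,\alpha,\xi)\cdot((z_i),\ell,d,\beta,\zeta)=((y_i+\varepsilon_1^{\delta_i^0}\alpha^{\varepsilon_1i}\xi z_{\varepsilon_1i}),\,k+\ell,\,b+\xi d,\,\alpha^{\varepsilon_2}\beta,\,\xi\zeta)$; for $\mathcal{W}_X(\lambda)$ with $\lambda\notin\{0,-1\}$: $((y_i),a,\alpha,\xi)\cdot((z_i),c,\beta,\zeta)=((y_i+\alpha^i\xi z_i),\,a+\xi c,\,\alpha\beta,\,\xi\zeta)$.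
   Context: All vector spaces are over $\mathbb{C}$. $\delta_n^0$ equals $1$ if $n=0$ and $0$ otherwise. $\mathcal{W}$ is the Witt algebra, with basis $\{L_n\}_{n\in\mathbb{Z}}$ and bracket $[L_n,L_m]=(m-n)L_{n+m}$. For $\lambda\in\mathbb{P}^1=\mathbb{C}\cup\{\infty\}$, $A(\lambda)$ and $B(\lambda)$ are the $\mathcal{W}$-modules with bases $\{A_n\}_{n\in\mathbb{Z}}$, $\{B_n\}_{n\in\mathbb{Z}}$ and actions $$L_n\cdot A_m=(n+m+n(n+1)\lambda\delta_m^0)A_{n+m},\qquad L_n\cdot B_m=(m-n(n+1)\lambda\delta_{n+m}^0)B_{n+m},$$ where for $\lambda=\infty$ the expression $n(n+1)\lambda$ is replaced by $n^2$. For $X\in\{A,B\}$, $\mathcal{W}_X(\lambda)=\mathcal{W}\ltimes X(\lambda)$ is the semi-direct sum in which $X(\lambda)$ is an abelian ideal and $[L_n,X_m]=L_n\cdot X_m$. $\mathbb{C}^\infty=\{(z_i)_{i\in\mathbb{Z}}\mid z_i\in\mathbb{C},\text{ all but finitely many }z_i\text{ zero}\}$ and $\mathbb{C}_0^\infty=\{(z_i)\in\mathbb{C}^\infty\mid z_0=0\}$, as additive groups. The underlying set of each group is the product of the listed factors in the listed order. *)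

theory Defs
  imports
    Complex_Main
    "HOL-Library.Poly_Mapping"
    "HOL-Library.Product_Plus"
    "HOL-Algebra.Elementary_Groups"
begin

section \<open>Lie algebras and their automorphism groups\<close>

locale lie_algebra = vector_space scale
  for scale :: "'k::field \<Rightarrow> 'a::ab_group_add \<Rightarrow> 'a" +
  fixes bracket :: "'a \<Rightarrow> 'a \<Rightarrow> 'a"
  assumes bracket_add_left: "bracket (x + y) z = bracket x z + bracket y z"
    and bracket_add_right: "bracket x (y + z) = bracket x y + bracket x z"
    and bracket_scale_left: "bracket (scale c x) y = scale c (bracket x y)"
    and bracket_scale_right: "bracket x (scale c y) = scale c (bracket x y)"
    and bracket_self: "bracket x x = 0"
    and jacobi: "bracket x (bracket y z) + bracket y (bracket z x) + bracket z (bracket x y) = 0"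

definition lie_aut_group ::
    "('k::field \<Rightarrow> 'a::ab_group_add \<Rightarrow> 'a) \<Rightarrow> ('a \<Rightarrow> 'a \<Rightarrow> 'a) \<Rightarrow> ('a \<Rightarrow> 'a) monoid" where
  "lie_aut_group scale bracket =
     \<lparr>carrier = {f. bij f \<and> Vector_Spaces.linear scale scale f
                  \<and> (\<forall>x y. f (bracket x y) = bracket (f x) (f y))},
      monoid.mult = (\<circ>), one = id\<rparr>"


section \<open>The Witt algebra, its modules, and the semi-direct sums\<close>

datatype module_kind = ModA | ModB

datatype proj_line = Fin complex | Infty

text \<open>The expression \<open>n(n+1)\<lambda>\<close>, which is read as \<open>n\<^sup>2\<close> at \<open>\<lambda> = \<infinity>\<close>.\<close>

primrec lam_term :: "proj_line \<Rightarrow> int \<Rightarrow> complex" where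
  "lam_term (Fin l) n = of_int (n * (n + 1)) * l"
| "lam_term Infty n = of_int (n\<^sup>2)"

text \<open>\<open>L\<^sub>n \<cdot> X\<^sub>m = mod_coeff X \<lambda> n m *\<^sub>C X\<^bsub>n+m\<^esub>\<close>.\<close>

primrec mod_coeff :: "module_kind \<Rightarrow> proj_line \<Rightarrow> int \<Rightarrow> int \<Rightarrow> complex" where
  "mod_coeff ModA l n m = of_int (n + m) + lam_term l n * of_bool (m = 0)"
| "mod_coeff ModB l n m = of_int m - lam_term l n * of_bool (n + m = 0)"

text \<open>A space with a basis indexed by the integers is represented by the finitely supported
  functions \<open>int \<Rightarrow>\<^sub>0 complex\<close>, the \<open>n\<close>-th basis vector being \<open>Poly_Mapping.single n 1\<close>.
  \<open>graded_ext c\<close> is the bilinear map that sends the basis vectors number \<open>n\<close> and \<open>m\<close> to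
  \<open>c n m\<close> times the basis vector number \<open>n + m\<close>.\<close>

definition graded_ext ::
    "(int \<Rightarrow> int \<Rightarrow> complex) \<Rightarrow> (int \<Rightarrow>\<^sub>0 complex) \<Rightarrow> (int \<Rightarrow>\<^sub>0 complex) \<Rightarrow> (int \<Rightarrow>\<^sub>0 complex)" where
  "graded_ext c f g =
     (\<Sum>n\<in>Poly_Mapping.keys f. \<Sum>m\<in>Poly_Mapping.keys g. Poly_Mapping.single (n + m)
        (c n m * Poly_Mapping.lookup f n * Poly_Mapping.lookup g m))"

definition witt_bracket :: "(int \<Rightarrow>\<^sub>0 complex) \<Rightarrow> (int \<Rightarrow>\<^sub>0 complex) \<Rightarrow> (int \<Rightarrow>\<^sub>0 complex)" where
  "witt_bracket = graded_ext (\<lambda>n m. of_int (m - n))"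

definition witt_act ::
    "module_kind \<Rightarrow> proj_line \<Rightarrow> (int \<Rightarrow>\<^sub>0 complex) \<Rightarrow> (int \<Rightarrow>\<^sub>0 complex) \<Rightarrow> (int \<Rightarrow>\<^sub>0 complex)" where
  "witt_act X l = graded_ext (mod_coeff X l)"

text \<open>In \<open>witt_sum\<close> the first component is the Witt algebra and the second one is the module.\<close>

type_synonym witt_sum = "(int \<Rightarrow>\<^sub>0 complex) \<times> (int \<Rightarrow>\<^sub>0 complex)"

definition witt_sum_scale :: "complex \<Rightarrow> witt_sum \<Rightarrow> witt_sum" where
  "witt_sum_scale c = map_prod (Poly_Mapping.map ((*) c)) (Poly_Mapping.map ((*) c))"

definition witt_sum_bracket :: "module_kind \<Rightarrow> proj_line \<Rightarrow> witt_sum \<Rightarrow> witt_sum \<Rightarrow> witt_sum" where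
  "witt_sum_bracket X l u v =
     (witt_bracket (fst u) (fst v), witt_act X l (fst u) (snd v) - witt_act X l (fst v) (snd u))"

definition Aut_W :: "module_kind \<Rightarrow> proj_line \<Rightarrow> (witt_sum \<Rightarrow> witt_sum) monoid" where
  "Aut_W X l = lie_aut_group witt_sum_scale (witt_sum_bracket X l)"


section \<open>The explicit groups\<close>

definition C_inf :: "(int \<Rightarrow> complex) set" where
  "C_inf = {z. finite {i. z i \<noteq> 0}}"

definition C0_inf :: "(int \<Rightarrow> complex) set" where
  "C0_inf = {z \<in> C_inf. z 0 = 0}"

definition Cx :: "complex set" where
  "Cx = UNIV - {0}"

abbreviation Z2 :: "int monoid" where
  "Z2 \<equiv> integer_mod_group 2"

text \<open>\<open>(-1)\<^sup>k\<close> for \<open>k \<in> \<int>/2\<int>\<close>, whose carrier is \<open>{0, 1}\<close>.\<close>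

definition eps :: "int \<Rightarrow> int" where
  "eps k = (- 1) ^ nat k"

definition grp_B0 ::
    "((int \<Rightarrow> complex) \<times> int \<times> complex \<times> complex \<times> complex \<times> complex) monoid" where
  "grp_B0 =
     \<lparr>carrier = C0_inf \<times> carrier Z2 \<times> UNIV \<times> UNIV \<times> Cx \<times> Cx,
      monoid.mult = (\<lambda>(y, k, a, b, \<alpha>, \<xi>) (z, l, c, d, \<beta>, \<zeta>).
        (\<lambda>i. y i + \<alpha> powi (eps k * i) * \<xi> * z (eps k * i),
         k \<otimes>\<^bsub>Z2\<^esub> l, of_int (eps l) * a + \<xi> * c, b + \<xi> * d, \<alpha> powi eps l * \<beta>, \<xi> * \<zeta>)),
      one = (\<lambda>i. 0, 0, 0, 0, 1, 1)\<rparr>"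

definition grp_A0_Bm1 ::
    "(int \<Rightarrow> complex) set \<Rightarrow> ((int \<Rightarrow> complex) \<times> int \<times> complex \<times> complex \<times> complex) monoid" where
  "grp_A0_Bm1 V =
     \<lparr>carrier = V \<times> carrier Z2 \<times> UNIV \<times> Cx \<times> Cx,
      monoid.mult = (\<lambda>(y, k, a, \<alpha>, \<xi>) (z, l, c, \<beta>, \<zeta>).
        (\<lambda>i. y i + \<alpha> powi (eps k * i) * \<xi> * z (eps k * i),
         k \<otimes>\<^bsub>Z2\<^esub> l, of_int (eps l) * a + \<xi> * c, \<alpha> powi eps l * \<beta>, \<xi> * \<zeta>)),
      one = (\<lambda>i. 0, 0, 0, 1, 1)\<rparr>"

definition grp_Am1 ::
    "((int \<Rightarrow> complex) \<times> int \<times> complex \<times> complex \<times> complex) monoid" where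
  "grp_Am1 =
     \<lparr>carrier = C_inf \<times> carrier Z2 \<times> UNIV \<times> Cx \<times> Cx,
      monoid.mult = (\<lambda>(y, k, b, \<alpha>, \<xi>) (z, l, d, \<beta>, \<zeta>).
        (\<lambda>i. y i + of_int (eps k) ^ of_bool (i = 0) * \<alpha> powi (eps k * i) * \<xi> * z (eps k * i),
         k \<otimes>\<^bsub>Z2\<^esub> l, b + \<xi> * d, \<alpha> powi eps l * \<beta>, \<xi> * \<zeta>)),
      one = (\<lambda>i. 0, 0, 0, 1, 1)\<rparr>"

definition grp_generic ::
    "(int \<Rightarrow> complex) set \<Rightarrow> ((int \<Rightarrow> complex) \<times> complex \<times> complex \<times> complex) monoid" where
  "grp_generic V =
     \<lparr>carrier = V \<times> UNIV \<times> Cx \<times> Cx,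
      monoid.mult = (\<lambda>(y, a, \<alpha>, \<xi>) (z, c, \<beta>, \<zeta>).
        (\<lambda>i. y i + \<alpha> powi i * \<xi> * z i, a + \<xi> * c, \<alpha> * \<beta>, \<xi> * \<zeta>)),
      one = (\<lambda>i. 0, 0, 1, 1)\<rparr>"


section \<open>Well-definedness\<close>

lemma group_lie_aut_group:
  assumes "vector_space scale"
  shows "group (lie_aut_group scale bracket)"
proof -
  interpret vector_space_pair scale scale
    using assms by (simp add: vector_space_pair_def)
  interpret vector_space scale by (rule assms)
  show ?thesis
  proof (rule groupI, goal_cases)
    case (1 f g)
    then show ?case
      by (auto simp: lie_aut_group_def bij_comp intro: Vector_Spaces.linear_compose)
  next
    case 2
    then show ?case by (simp add: lie_aut_group_def vs1.linear_id)
  next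
    case (5 f)
    then have f: "bij f" "Vector_Spaces.linear scale scale f"
      "\<And>x y. f (bracket x y) = bracket (f x) (f y)"
      by (auto simp: lie_aut_group_def)
    have ff: "f (inv_into UNIV f x) = x" "inv_into UNIV f (f x) = x" for x
      using f(1) by (simp_all add: bij_is_surj surj_f_inv_f bij_is_inj)
    have "Vector_Spaces.linear scale scale (inv_into UNIV f)"
      using f(2) ff by unfold_locales
        (metis linear_add[OF f(2)] ff, metis linear_scale[OF f(2)] ff)
    moreover have "inv_into UNIV f (bracket x y) = bracket (inv_into UNIV f x) (inv_into UNIV f y)" for x y
      by (metis f(3) ff)
    ultimately show ?case
      using f(1) by (intro bexI[of _ "inv_into UNIV f"])
        (auto simp: lie_aut_group_def bij_imp_bij_inv fun_eq_iff ff)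
  qed (auto simp: lie_aut_group_def fun_eq_iff)
qed

lemma lookup_cmult [simp]: "Poly_Mapping.lookup (Poly_Mapping.map ((*) (c::complex)) f) i = c * Poly_Mapping.lookup f i"
  by (simp add: Poly_Mapping.map.rep_eq when_def)

lemma graded_ext_superset:
  assumes "finite S" "finite T" "Poly_Mapping.keys f \<subseteq> S" "Poly_Mapping.keys g \<subseteq> T"
  shows "graded_ext c f g = (\<Sum>n\<in>S. \<Sum>m\<in>T. Poly_Mapping.single (n + m)
           (c n m * Poly_Mapping.lookup f n * Poly_Mapping.lookup g m))"
proof -
  have "graded_ext c f g = (\<Sum>n\<in>S. \<Sum>m\<in>Poly_Mapping.keys g. Poly_Mapping.single (n + m)
           (c n m * Poly_Mapping.lookup f n * Poly_Mapping.lookup g m))"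
    unfolding graded_ext_def using assms
    by (intro sum.mono_neutral_left) (auto simp: in_keys_iff)
  also have "\<dots> = (\<Sum>n\<in>S. \<Sum>m\<in>T. Poly_Mapping.single (n + m)
           (c n m * Poly_Mapping.lookup f n * Poly_Mapping.lookup g m))"
    using assms by (intro sum.cong refl sum.mono_neutral_left) (auto simp: in_keys_iff)
  finally show ?thesis .
qed

lemma graded_ext_add_left: "graded_ext c (f + f') g = graded_ext c f g + graded_ext c f' g"
proof -
  let ?S = "Poly_Mapping.keys f \<union> Poly_Mapping.keys f'" and ?T = "Poly_Mapping.keys g"
  have "Poly_Mapping.keys (f + f') \<subseteq> ?S" by (rule Poly_Mapping.keys_add)
  then show ?thesis
    by (simp add: graded_ext_superset[of ?S ?T] lookup_add single_add algebra_simps sum.distrib)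
qed

lemma graded_ext_add_right: "graded_ext c f (g + g') = graded_ext c f g + graded_ext c f g'"
proof -
  let ?S = "Poly_Mapping.keys f" and ?T = "Poly_Mapping.keys g \<union> Poly_Mapping.keys g'"
  have "Poly_Mapping.keys (g + g') \<subseteq> ?T" by (rule Poly_Mapping.keys_add)
  then show ?thesis
    by (simp add: graded_ext_superset[of ?S ?T] lookup_add single_add algebra_simps sum.distrib)
qed

lemma lookup_graded_ext:
  assumes "finite S" "finite T" "Poly_Mapping.keys f \<subseteq> S" "Poly_Mapping.keys g \<subseteq> T"
  shows "Poly_Mapping.lookup (graded_ext c f g) i = (\<Sum>n\<in>S. \<Sum>m\<in>T. if n + m = i then
           c n m * Poly_Mapping.lookup f n * Poly_Mapping.lookup g m else 0)"
  by (simp add: graded_ext_superset[OF assms] lookup_sum lookup_single when_def)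

lemma graded_ext_single [simp]:
  "graded_ext c (Poly_Mapping.single n a) (Poly_Mapping.single m b)
     = Poly_Mapping.single (n + m) (c n m * a * b)"
  by (subst graded_ext_superset[of "{n}" "{m}"]) auto

lemma graded_ext_scale_left:
  "graded_ext c (Poly_Mapping.map ((*) a) f) g = Poly_Mapping.map ((*) a) (graded_ext c f g)"
proof (rule poly_mapping_eqI)
  fix i
  let ?S = "Poly_Mapping.keys f" and ?T = "Poly_Mapping.keys g"
  have "Poly_Mapping.keys (Poly_Mapping.map ((*) a) f) \<subseteq> ?S" by (auto simp: in_keys_iff)
  then show "Poly_Mapping.lookup (graded_ext c (Poly_Mapping.map ((*) a) f) g) i
     = Poly_Mapping.lookup (Poly_Mapping.map ((*) a) (graded_ext c f g)) i"
    by (auto simp: lookup_graded_ext[of ?S ?T] sum_distrib_left intro!: sum.cong)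
qed

lemma graded_ext_scale_right:
  "graded_ext c f (Poly_Mapping.map ((*) a) g) = Poly_Mapping.map ((*) a) (graded_ext c f g)"
proof (rule poly_mapping_eqI)
  fix i
  let ?S = "Poly_Mapping.keys f" and ?T = "Poly_Mapping.keys g"
  have "Poly_Mapping.keys (Poly_Mapping.map ((*) a) g) \<subseteq> ?T" by (auto simp: in_keys_iff)
  then show "Poly_Mapping.lookup (graded_ext c f (Poly_Mapping.map ((*) a) g)) i
     = Poly_Mapping.lookup (Poly_Mapping.map ((*) a) (graded_ext c f g)) i"
    by (auto simp: lookup_graded_ext[of ?S ?T] sum_distrib_left intro!: sum.cong)
qed

lemma graded_ext_zero [simp]: "graded_ext c 0 g = 0" "graded_ext c f 0 = 0"
  by (simp_all add: graded_ext_def)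

lemma basis_induct [case_names zero add single]:
  fixes f :: "int \<Rightarrow>\<^sub>0 complex"
  assumes "P 0" "\<And>f g. P f \<Longrightarrow> P g \<Longrightarrow> P (f + g)" "\<And>n a. P (Poly_Mapping.single n a)"
  shows "P f"
proof -
  have "P (\<Sum>n\<in>S. Poly_Mapping.single n (Poly_Mapping.lookup f n))" if "finite S" for S
    using that by (induction S) (auto simp: assms)
  moreover have "f = (\<Sum>n\<in>Poly_Mapping.keys f. Poly_Mapping.single n (Poly_Mapping.lookup f n))"
    by (rule poly_mapping_eqI) (auto simp: lookup_sum lookup_single when_def in_keys_iff)
  ultimately show ?thesis by (metis finite_keys)
qed

lemma witt_bracket_antisym: "witt_bracket f g = - witt_bracket g f"
proof (induction f rule: basis_induct)
  case (single n a)
  show ?case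
  proof (induction g rule: basis_induct)
    case (single m b)
    show ?case
      by (simp add: witt_bracket_def single_uminus[symmetric] algebra_simps)
  qed (simp_all add: witt_bracket_def graded_ext_add_left graded_ext_add_right)
qed (simp_all add: witt_bracket_def graded_ext_add_left graded_ext_add_right)

lemma mod_coeff_rep:
  "mod_coeff X l m k * mod_coeff X l n (m + k) - mod_coeff X l n k * mod_coeff X l m (n + k)
     = of_int (m - n) * mod_coeff X l (n + m) k"
proof (cases X)
  case ModA
  consider "k = 0" "m = 0" | "k = 0" "n = 0" | "k = 0" "m \<noteq> 0" "n \<noteq> 0" | "k \<noteq> 0" "m = - k" "n = - k"
    | "k \<noteq> 0" "m = - k" "n \<noteq> - k" | "k \<noteq> 0" "m \<noteq> - k" "n = - k" | "k \<noteq> 0" "m + k \<noteq> 0" "n + k \<noteq> 0"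
    by linarith
  then show ?thesis
    by cases (use ModA in \<open>cases l; simp add: algebra_simps power2_eq_square\<close>)+
next
  case ModB
  consider "m + k = 0" "n + k = 0" | "m + k = 0" "n + k \<noteq> 0" | "m + k \<noteq> 0" "n + k = 0"
    | "m + k \<noteq> 0" "n + k \<noteq> 0" "n + m + k = 0" | "m + k \<noteq> 0" "n + k \<noteq> 0" "n + m + k \<noteq> 0"
    by linarith
  then show ?thesis
  proof cases
    case 1
    then have "m = - k" "n = - k" by linarith+
    then show ?thesis using ModB by (cases l; simp)
  next
    case 2
    then have "m = - k" by linarith
    then show ?thesis using ModB 2(2) by (cases l; cases "n = 0"; simp add: algebra_simps power2_eq_square)
  next
    case 3
    then have "n = - k" by linarith
    then show ?thesis using ModB 3(1) by (cases l; cases "m = 0"; simp add: algebra_simps power2_eq_square)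
  next
    case 4
    then have k: "k = - n - m" and nz: "n \<noteq> 0" "m \<noteq> 0" by linarith+
    show ?thesis unfolding k using ModB nz by (cases l; simp add: algebra_simps power2_eq_square)
  next
    case 5
    then show ?thesis using ModB by (cases l; simp add: algebra_simps power2_eq_square)
  qed
qed

lemma graded_ext_bracket:
  assumes "\<And>n m k. c m k * c n (m + k) - c n k * c m (n + k) = of_int (m - n) * c (n + m) k"
  shows "graded_ext c (witt_bracket f g) v
     = graded_ext c f (graded_ext c g v) - graded_ext c g (graded_ext c f v)"
proof (induction f rule: basis_induct)
  case (single n a)
  show ?case
  proof (induction g rule: basis_induct)
    case (single m b)
    show ?case
    proof (induction v rule: basis_induct)
      case (single k d)
      have "of_int (m - n) * a * b * d * c (n + m) k
          = c n (m + k) * a * (c m k * b * d) - c m (n + k) * b * (c n k * a * d)"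
        unfolding mult.commute[of _ "c (n + m) k"] using assms[of m k n]
        by (simp add: algebra_simps) (metis (no_types, lifting) distrib_left mult.assoc mult.commute)
      then show ?case
        by (simp add: witt_bracket_def single_diff[symmetric] add.left_commute add.assoc mult_ac)
    qed (simp_all add: graded_ext_add_right)
  qed (simp_all add: witt_bracket_def graded_ext_add_left graded_ext_add_right)
qed (simp_all add: witt_bracket_def graded_ext_add_left graded_ext_add_right)

lemma witt_act_bracket:
  "witt_act X l (witt_bracket f g) v
     = witt_act X l f (witt_act X l g v) - witt_act X l g (witt_act X l f v)"
  unfolding witt_act_def by (rule graded_ext_bracket) (rule mod_coeff_rep)

lemma witt_bracket_bracket:
  "witt_bracket (witt_bracket f g) h
     = witt_bracket f (witt_bracket g h) - witt_bracket g (witt_bracket f h)"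
  using graded_ext_bracket[of "\<lambda>n m. of_int (m - n)" f g h]
  by (simp add: witt_bracket_def algebra_simps)

lemma lie_algebra_witt_sum: "lie_algebra witt_sum_scale (witt_sum_bracket X l)"
proof
  note defs = witt_sum_scale_def witt_sum_bracket_def witt_act_def
  fix a b :: complex and x y z :: witt_sum
  show "witt_sum_scale a (x + y) = witt_sum_scale a x + witt_sum_scale a y"
    "witt_sum_scale (a + b) x = witt_sum_scale a x + witt_sum_scale b x"
    "witt_sum_scale a (witt_sum_scale b x) = witt_sum_scale (a * b) x"
    "witt_sum_scale 1 x = x"
    by (cases x; cases y; auto simp: defs intro!: poly_mapping_eqI simp: lookup_add algebra_simps)+
  show "witt_sum_bracket X l (x + y) z = witt_sum_bracket X l x z + witt_sum_bracket X l y z"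
    "witt_sum_bracket X l x (y + z) = witt_sum_bracket X l x y + witt_sum_bracket X l x z"
    by (simp_all add: defs witt_bracket_def graded_ext_add_left graded_ext_add_right)
  show "witt_sum_bracket X l (witt_sum_scale a x) y = witt_sum_scale a (witt_sum_bracket X l x y)"
    "witt_sum_bracket X l x (witt_sum_scale a y) = witt_sum_scale a (witt_sum_bracket X l x y)"
    by (auto simp: defs witt_bracket_def graded_ext_scale_left graded_ext_scale_right
        lookup_minus right_diff_distrib intro!: poly_mapping_eqI)
  have "witt_bracket (fst x) (fst x) = 0"
  proof (rule poly_mapping_eqI)
    fix i
    show "Poly_Mapping.lookup (witt_bracket (fst x) (fst x)) i = Poly_Mapping.lookup 0 i"
      using arg_cong[OF witt_bracket_antisym[of "fst x" "fst x"], of "\<lambda>h. Poly_Mapping.lookup h i"]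
      by simp
  qed
  then show "witt_sum_bracket X l x x = 0"
    by (simp add: witt_sum_bracket_def zero_prod_def)
  have sub: "witt_act X l f (v - w) = witt_act X l f v - witt_act X l f w" for f v w
    by (metis add_diff_cancel_right' diff_add_cancel graded_ext_add_right witt_act_def)
  have neg: "witt_bracket f (- g) = - witt_bracket f g" for f g
    by (metis add.right_inverse add_eq_0_iff graded_ext_add_right graded_ext_zero(2) witt_bracket_def)
  have neg': "witt_act X l (- f) v = - witt_act X l f v" for f v
    by (metis add.right_inverse add_eq_0_iff graded_ext_add_left graded_ext_zero(1) witt_act_def)
  show "witt_sum_bracket X l x (witt_sum_bracket X l y z) + witt_sum_bracket X l y (witt_sum_bracket X l z x)
      + witt_sum_bracket X l z (witt_sum_bracket X l x y) = 0"
    using witt_bracket_bracket[of "fst x" "fst y" "fst z"]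
      witt_bracket_antisym[of "fst z" "witt_bracket (fst x) (fst y)"]
      witt_bracket_antisym[of "fst z" "fst x"]
    by (simp add: witt_sum_bracket_def zero_prod_def witt_act_bracket sub neg neg')
qed

lemma group_Aut_W: "group (Aut_W X l)"
  unfolding Aut_W_def
  by (rule group_lie_aut_group) (rule lie_algebra.axioms(1)[OF lie_algebra_witt_sum])

text \<open>The basis vectors of \<open>witt_sum\<close>, with the defining brackets.\<close>

abbreviation gen_L :: "int \<Rightarrow> witt_sum" where
  "gen_L n \<equiv> (Poly_Mapping.single n 1, 0)"

abbreviation gen_X :: "int \<Rightarrow> witt_sum" where
  "gen_X n \<equiv> (0, Poly_Mapping.single n 1)"

lemma witt_sum_bracket_gens:
  "witt_sum_bracket X l (gen_L n) (gen_L m) = witt_sum_scale (of_int (m - n)) (gen_L (n + m))"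
  "witt_sum_bracket X l (gen_L n) (gen_X m) = witt_sum_scale (mod_coeff X l n m) (gen_X (n + m))"
  "witt_sum_bracket X l (gen_X n) (gen_X m) = 0"
  by (auto simp: witt_sum_bracket_def witt_sum_scale_def witt_bracket_def witt_act_def zero_prod_def
      intro!: poly_mapping_eqI simp: lookup_single when_def)

lemma eps_cases: "k \<in> carrier Z2 \<Longrightarrow> (k = 0 \<and> eps k = 1) \<or> (k = 1 \<and> eps k = - 1)"
proof -
  assume "k \<in> carrier Z2"
  then have "k = 0 \<or> k = 1" by (auto simp: carrier_integer_mod_group)
  then show ?thesis by (auto simp: eps_def)
qed

lemma C_inf_comb:
  assumes "y \<in> C_inf" "z \<in> C_inf" "s = 1 \<or> s = - 1"
  shows "(\<lambda>i. y i + e i * z (s * i)) \<in> C_inf"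
proof -
  have "{i. z (s * i) \<noteq> 0} \<subseteq> (*) s ` {i. z i \<noteq> 0}"
    using assms(3) by (auto intro!: image_eqI[of _ _ "s * _"])
  then have "finite ({i. y i \<noteq> 0} \<union> {i. z (s * i) \<noteq> 0})"
    using assms(1,2) by (auto simp: C_inf_def intro: finite_subset)
  then show ?thesis
    unfolding C_inf_def mem_Collect_eq by (rule rev_finite_subset) auto
qed

lemma C0_inf_comb:
  assumes "y \<in> C0_inf" "z \<in> C0_inf" "s = 1 \<or> s = - 1"
  shows "(\<lambda>i. y i + e i * z (s * i)) \<in> C0_inf"
  using assms C_inf_comb[of y z s e] by (auto simp: C0_inf_def)

lemma C_inf_neg:
  assumes "y \<in> C_inf" "s = 1 \<or> s = - 1"
  shows "(\<lambda>i. e i * y (s * i)) \<in> C_inf"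
  using C_inf_comb[of "\<lambda>i. 0" y s e] assms by (simp add: C_inf_def)

lemma C0_inf_neg:
  assumes "y \<in> C0_inf" "s = 1 \<or> s = - 1"
  shows "(\<lambda>i. e i * y (s * i)) \<in> C0_inf"
  using assms C_inf_neg[of y s e] by (auto simp: C0_inf_def)

lemma zero_C_inf: "(\<lambda>i. 0) \<in> C_inf" "(\<lambda>i. 0) \<in> C0_inf"
  by (auto simp: C_inf_def C0_inf_def)

lemma eps_pm: "k \<in> carrier Z2 \<Longrightarrow> eps k = 1 \<or> eps k = - 1"
  using eps_cases by blast

lemmas eps_comb = C_inf_comb[OF _ _ eps_pm] C0_inf_comb[OF _ _ eps_pm]

lemmas eps_neg = C_inf_neg[OF _ eps_pm, where e = "\<lambda>i. - e i" for e, simplified mult_minus_left]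
  C0_inf_neg[OF _ eps_pm, where e = "\<lambda>i. - e i" for e, simplified mult_minus_left]

lemma group_grp_generic:
  assumes "V = C_inf \<or> V = C0_inf"
  shows "group (grp_generic V)"
proof -
  have zero: "(\<lambda>i. 0) \<in> V"
    and comb: "\<And>y z e. y \<in> V \<Longrightarrow> z \<in> V \<Longrightarrow> (\<lambda>i. y i + e i * z i) \<in> V"
    and neg: "\<And>y e. y \<in> V \<Longrightarrow> (\<lambda>i. e i * y i) \<in> V"
    using assms zero_C_inf C_inf_comb[where s = 1] C0_inf_comb[where s = 1]
      C_inf_neg[where s = 1] C0_inf_neg[where s = 1] by auto
  show ?thesis
  proof (rule groupI, goal_cases)
    case (1 p q)
    then show ?case by (auto simp: grp_generic_def Cx_def comb)
  next
    case (3 p q r)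
    then show ?case by (auto simp: grp_generic_def Cx_def algebra_simps power_int_mult_distrib)
  next
    case (5 p)
    obtain y a \<alpha> \<xi> where p: "p = (y, a, \<alpha>, \<xi>)" by (metis prod_cases4)
    with 5 show ?case
      by (intro bexI[of _ "(\<lambda>i. - (inverse \<alpha> powi i * inverse \<xi>) * y i, - inverse \<xi> * a, inverse \<alpha>, inverse \<xi>)"])
        (auto simp: grp_generic_def Cx_def neg[where e = "\<lambda>i. - e i" for e, simplified])
  qed (use zero in \<open>auto simp: grp_generic_def Cx_def\<close>)
qed

lemma group_grp_A0_Bm1:
  assumes "V = C_inf \<or> V = C0_inf"
  shows "group (grp_A0_Bm1 V)"
proof -
  have zero: "(\<lambda>i. 0) \<in> V"
    and comb: "\<And>y z e k. y \<in> V \<Longrightarrow> z \<in> V \<Longrightarrow> k \<in> carrier Z2 \<Longrightarrow> (\<lambda>i. y i + e i * z (eps k * i)) \<in> V"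
    and neg: "\<And>y e k. y \<in> V \<Longrightarrow> k \<in> carrier Z2 \<Longrightarrow> (\<lambda>i. - (e i * y (eps k * i))) \<in> V"
    using assms by (auto intro: zero_C_inf eps_comb eps_neg)
  show ?thesis
  proof (rule groupI, goal_cases)
    case (1 p q)
    then show ?case
      using monoid.m_closed[OF group.is_monoid[OF group_integer_mod_group[of 2]]]
      by (auto simp: grp_A0_Bm1_def Cx_def
          intro!: comb[where e = "\<lambda>i. \<alpha> powi (eps k * i) * \<xi>" and k = k for \<alpha> \<xi> k])
  next
    case (3 p q r)
    then show ?case
      by (auto simp: grp_A0_Bm1_def Cx_def field_simps power_int_mult_distrib power_int_divide_distrib power_int_minus
          power_int_inverse eps_def dest!: eps_cases)
  next
    case (5 p)
    obtain y k a \<alpha> \<xi> where p: "p = (y, k, a, \<alpha>, \<xi>)" by (metis prod_cases5)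
    let ?q = "(\<lambda>i. - ((\<alpha> powi (- eps k)) powi (eps k * i) * inverse \<xi> * y (eps k * i)),
            k, - of_int (eps k) * inverse \<xi> * a, \<alpha> powi (- eps k), inverse \<xi>)"
    from p 5 have "?q \<in> carrier (grp_A0_Bm1 V)"
      by (auto simp: grp_A0_Bm1_def Cx_def
          intro!: neg[where e = "\<lambda>i. (\<alpha> powi (- eps k)) powi (eps k * i) * inverse \<xi>" and k = k])
    moreover from p 5 have "?q \<otimes>\<^bsub>grp_A0_Bm1 V\<^esub> p = \<one>\<^bsub>grp_A0_Bm1 V\<^esub>"
      by (auto simp: grp_A0_Bm1_def Cx_def dest!: eps_cases)
    ultimately show ?case by blast
  qed (use zero in \<open>auto simp: grp_A0_Bm1_def Cx_def eps_def dest: eps_cases\<close>)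
qed

lemma group_grp_Am1: "group grp_Am1"
proof -
  note zero = zero_C_inf(1)
  have comb: "\<And>y z e k. y \<in> C_inf \<Longrightarrow> z \<in> C_inf \<Longrightarrow> k \<in> carrier Z2 \<Longrightarrow> (\<lambda>i. y i + e i * z (eps k * i)) \<in> C_inf"
    and neg: "\<And>y e k. y \<in> C_inf \<Longrightarrow> k \<in> carrier Z2 \<Longrightarrow> (\<lambda>i. - (e i * y (eps k * i))) \<in> C_inf"
    by (intro eps_comb eps_neg; assumption)+
  show ?thesis
  proof (rule groupI, goal_cases)
    case (1 p q)
    then show ?case
      using monoid.m_closed[OF group.is_monoid[OF group_integer_mod_group[of 2]]]
      by (auto simp: grp_Am1_def Cx_def
          intro!: comb[where e = "\<lambda>i. of_int (eps k) ^ of_bool (i = 0) * \<alpha> powi (eps k * i) * \<xi>" and k = k for \<alpha> \<xi> k])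
  next
    case (3 p q r)
    then show ?case
      by (auto simp: grp_Am1_def Cx_def field_simps power_int_mult_distrib power_int_divide_distrib power_int_minus
          power_int_inverse eps_def fun_eq_iff dest!: eps_cases)
  next
    case (5 p)
    obtain y k b \<alpha> \<xi> where p: "p = (y, k, b, \<alpha>, \<xi>)" by (metis prod_cases5)
    let ?q = "(\<lambda>i. - (of_int (eps k) ^ of_bool (i = 0) * (\<alpha> powi (- eps k)) powi (eps k * i) * inverse \<xi>
              * y (eps k * i)),
            k, - inverse \<xi> * b, \<alpha> powi (- eps k), inverse \<xi>)"
    from p 5 have "?q \<in> carrier grp_Am1"
      by (auto simp: grp_Am1_def Cx_def
          intro!: neg[where e = "\<lambda>i. of_int (eps k) ^ of_bool (i = 0) * (\<alpha> powi (- eps k)) powi (eps k * i) * inverse \<xi>" and k = k])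
    moreover from p 5 have "?q \<otimes>\<^bsub>grp_Am1\<^esub> p = \<one>\<^bsub>grp_Am1\<^esub>"
      by (auto simp: grp_Am1_def Cx_def dest!: eps_cases)
    ultimately show ?case by blast
  qed (use zero in \<open>auto simp: grp_Am1_def Cx_def eps_def dest: eps_cases\<close>)
qed

lemma group_grp_B0: "group grp_B0"
proof -
  note zero = zero_C_inf(2)
  have comb: "\<And>y z e k. y \<in> C0_inf \<Longrightarrow> z \<in> C0_inf \<Longrightarrow> k \<in> carrier Z2 \<Longrightarrow> (\<lambda>i. y i + e i * z (eps k * i)) \<in> C0_inf"
    and neg: "\<And>y e k. y \<in> C0_inf \<Longrightarrow> k \<in> carrier Z2 \<Longrightarrow> (\<lambda>i. - (e i * y (eps k * i))) \<in> C0_inf"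
    by (intro eps_comb eps_neg; assumption)+
  show ?thesis
  proof (rule groupI, goal_cases)
    case (1 p q)
    then show ?case
      using monoid.m_closed[OF group.is_monoid[OF group_integer_mod_group[of 2]]]
      by (auto simp: grp_B0_def Cx_def
          intro!: comb[where e = "\<lambda>i. \<alpha> powi (eps k * i) * \<xi>" and k = k for \<alpha> \<xi> k])
  next
    case (3 p q r)
    then show ?case
      by (auto simp: grp_B0_def Cx_def field_simps power_int_mult_distrib power_int_divide_distrib power_int_minus
          power_int_inverse eps_def dest!: eps_cases)
  next
    case (5 p)
    obtain y k a b \<alpha> \<xi> where p: "p = (y, k, a, b, \<alpha>, \<xi>)" by (metis prod_cases6)
    let ?q = "(\<lambda>i. - ((\<alpha> powi (- eps k)) powi (eps k * i) * inverse \<xi> * y (eps k * i)),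
            k, - of_int (eps k) * inverse \<xi> * a, - inverse \<xi> * b, \<alpha> powi (- eps k), inverse \<xi>)"
    from p 5 have "?q \<in> carrier grp_B0"
      by (auto simp: grp_B0_def Cx_def
          intro!: neg[where e = "\<lambda>i. (\<alpha> powi (- eps k)) powi (eps k * i) * inverse \<xi>" and k = k])
    moreover from p 5 have "?q \<otimes>\<^bsub>grp_B0\<^esub> p = \<one>\<^bsub>grp_B0\<^esub>"
      by (auto simp: grp_B0_def Cx_def dest!: eps_cases)
    ultimately show ?case by blast
  qed (use zero in \<open>auto simp: grp_B0_def Cx_def eps_def dest: eps_cases\<close>)
qed

end

theory Submission
  imports Defs
begin

text \<open>
  Write \<open>W\<close> for the Witt algebra and \<open>M\<close> for the module \<open>X(\<lambda>)\<close>. A nonzero element of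
  \<open>W\<close> has a leading term, and leading terms of brackets are easy to compute; this shows that
  \<open>W\<close> has no nonzero abelian ideal (\<open>witt_no_abelian_ideal\<close>). Hence an automorphism \<open>f\<close> of
  the semi-direct sum maps \<open>M\<close> to itself and is triangular:
  \<open>f (u, v) = (\<sigma> u, \<phi> v + D (\<sigma> u))\<close>, where \<open>\<sigma>\<close> is an automorphism of \<open>W\<close>,
  \<open>\<phi>\<close> is a bijection of \<open>M\<close> with \<open>\<phi> (u v) = \<sigma> u \<phi> v\<close>, and \<open>D\<close> is a
  derivation from \<open>W\<close> to \<open>M\<close>. Conversely every such triple gives an automorphism
  (\<open>triangular_aut\<close>), so three classifications are needed.

  The element \<open>L\<^sub>0\<close> acts diagonally with its eigenvalues the degrees, and \<open>\<sigma> L\<^sub>0\<close> must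
  again be diagonalisable on \<open>W\<close>. Leading terms exclude every component of \<open>\<sigma> L\<^sub>0\<close> of
  nonzero degree, so \<open>\<sigma>\<close> respects the weights up to a sign \<open>s\<close>, and
  \<open>\<sigma> L\<^sub>n = s \<alpha>\<^sup>n L\<^bsub>sn\<^esub>\<close> (\<open>witt_aut_classification\<close>).

  The action on \<open>M\<close> is uniform except at one index, where it involves the polynomial
  \<open>n (p + q n)\<close>; here \<open>p\<close> and \<open>q\<close> depend on \<open>\<lambda>\<close>, with \<open>q = 0\<close> for
  \<open>\<lambda> = 0\<close> and \<open>p = 0\<close> for \<open>\<lambda> = - 1\<close>. Rescalings always lift to \<open>M\<close>. The
  reflection \<open>s = - 1\<close> replaces \<open>q\<close> by \<open>- q\<close> and lifts exactly if \<open>p q = 0\<close>, with a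
  sign at the exceptional index if \<open>p = 0\<close>. The lift is unique up to a scalar \<open>\<xi>\<close>
  (\<open>mod_aut_classification\<close>).

  Modulo inner derivations, which are parametrised by \<open>M\<close> up to the invariant \<open>B\<^sub>0\<close> of
  \<open>B(\<lambda>)\<close>, a derivation is diagonal. Its eigenvalues, multiplied by the degree in the case of
  \<open>B(\<lambda>)\<close>, satisfy a recurrence whose solutions are the quadratic polynomials without
  constant term. What remains is one outer derivation, or two for
  \<open>B(0)\<close> (\<open>derivation_classification\<close>). Under the reflection some of them change sign and
  some do not, which explains the different signs in the group laws.

  Altogether the automorphisms are parametrised by tuples \<open>(y, k, a, b, \<alpha>, \<xi>)\<close>, and composition
  becomes one multiplication rule (\<open>param_aut_mult\<close>). The groups of the theorem are the
  restrictions of this rule to the tuples that occur for the given module.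
\<close>

section \<open>Linear maps on finitely supported functions\<close>

abbreviation lk :: "(int \<Rightarrow>\<^sub>0 complex) \<Rightarrow> int \<Rightarrow> complex" where
  "lk \<equiv> Poly_Mapping.lookup"

abbreviation sg :: "int \<Rightarrow> complex \<Rightarrow> (int \<Rightarrow>\<^sub>0 complex)" where
  "sg \<equiv> Poly_Mapping.single"

abbreviation smul :: "complex \<Rightarrow> (int \<Rightarrow>\<^sub>0 complex) \<Rightarrow> (int \<Rightarrow>\<^sub>0 complex)" where
  "smul c \<equiv> Poly_Mapping.map ((*) c)"

definition linear_pm :: "((int \<Rightarrow>\<^sub>0 complex) \<Rightarrow> (int \<Rightarrow>\<^sub>0 complex)) \<Rightarrow> bool" where
  "linear_pm F \<longleftrightarrow> (\<forall>u v. F (u + v) = F u + F v) \<and> (\<forall>c u. F (smul c u) = smul c (F u))"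

lemma linear_pmI:
  "(\<And>u v. F (u + v) = F u + F v) \<Longrightarrow> (\<And>c u. F (smul c u) = smul c (F u)) \<Longrightarrow> linear_pm F"
  by (simp add: linear_pm_def)

lemma linear_pmD:
  assumes "linear_pm F"
  shows "F (u + v) = F u + F v" "F (smul c u) = smul c (F u)" "F 0 = 0" "F (- u) = - F u"
    "F (u - v) = F u - F v"
proof -
  show add: "F (u + v) = F u + F v" for u v
    using assms by (auto simp: linear_pm_def)
  show "F (smul c u) = smul c (F u)"
    using assms by (auto simp: linear_pm_def)
  show zero: "F 0 = 0" using add[of 0 0] by simp
  show neg: "F (- u) = - F u" for u
    using add[of u "- u"] zero by (simp add: eq_neg_iff_add_eq_0 add.commute)
  show "F (u - v) = F u - F v" using add[of u "- v"] neg by simp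
qed

lemma sg_smul: "sg n a = smul a (sg n 1)"
  by (rule poly_mapping_eqI) (simp add: lookup_single when_def)

lemma smul_sg [simp]: "smul c (sg n a) = sg n (c * a)"
  by (rule poly_mapping_eqI) (simp add: lookup_single when_def)

lemma smul_add [simp]: "smul c (u + v) = smul c u + smul c v"
  by (rule poly_mapping_eqI) (simp add: lookup_add algebra_simps)

lemma smul_diff [simp]: "smul c (u - v) = smul c u - smul c v"
  by (rule poly_mapping_eqI) (simp add: lookup_minus algebra_simps)

lemma smul_zero [simp]: "smul c 0 = 0"
  by (rule poly_mapping_eqI) simp

lemma linear_pm_eqI:
  assumes "linear_pm F" "linear_pm G" "\<And>n. F (sg n 1) = G (sg n 1)"
  shows "F u = G u"
proof (induction u rule: basis_induct)
  case zero
  show ?case by (simp add: linear_pmD(3) assms)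
next
  case (add f g)
  then show ?case by (simp add: linear_pmD(1) assms)
next
  case (single n a)
  show ?case unfolding sg_smul[of n a] by (simp only: linear_pmD(2)[OF assms(1)] linear_pmD(2)[OF assms(2)] assms(3))
qed

lemma linear_pm_comp: "linear_pm F \<Longrightarrow> linear_pm G \<Longrightarrow> linear_pm (\<lambda>u. F (G u))"
  by (simp add: linear_pm_def)

lemma linear_pm_add: "linear_pm F \<Longrightarrow> linear_pm G \<Longrightarrow> linear_pm (\<lambda>u. F u + G u)"
  by (simp add: linear_pm_def add_ac)

lemma linear_pm_diff: "linear_pm F \<Longrightarrow> linear_pm G \<Longrightarrow> linear_pm (\<lambda>u. F u - G u)"
  by (simp add: linear_pm_def algebra_simps)

lemma linear_pm_graded_ext:
  "linear_pm (\<lambda>u. graded_ext c u v)" "linear_pm (graded_ext c u)"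
  by (auto intro!: linear_pmI simp: graded_ext_add_left graded_ext_add_right
      graded_ext_scale_left graded_ext_scale_right)

text \<open>Identities between bilinear maps are reduced by this rule to pairs of basis vectors; this turns the
  homomorphism, equivariance and cocycle conditions below into identities between coefficients.\<close>

lemma bilinear_pm_eqI:
  assumes "\<And>v. linear_pm (\<lambda>u. F u v)" "\<And>v. linear_pm (\<lambda>u. G u v)"
    and "\<And>u. linear_pm (F u)" "\<And>u. linear_pm (G u)"
    and "\<And>n m. F (sg n 1) (sg m 1) = G (sg n 1) (sg m 1)"
  shows "F u v = G u v"
proof -
  have "F (sg n 1) v = G (sg n 1) v" for n
    by (rule linear_pm_eqI[of "F (sg n 1)" "G (sg n 1)"]) (rule assms)+
  then show ?thesis
    by (rule linear_pm_eqI[of "\<lambda>u. F u v" "\<lambda>u. G u v", OF assms(1,2)])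
qed

lemma lookup_graded_ext_single_left:
  "lk (graded_ext c (sg n a) v) i = c n (i - n) * a * lk v (i - n)"
proof -
  define T where "T = insert (i - n) (Poly_Mapping.keys v)"
  have T: "finite T" "i - n \<in> T" "Poly_Mapping.keys v \<subseteq> T" by (auto simp: T_def)
  have "lk (graded_ext c (sg n a) v) i
      = (\<Sum>k\<in>{n}. \<Sum>m\<in>T. if k + m = i then c k m * lk (sg n a) k * lk v m else 0)"
    by (rule lookup_graded_ext) (use T in auto)
  also have "\<dots> = (\<Sum>m\<in>T. if m = i - n then c n m * a * lk v m else 0)"
    by (auto intro!: sum.cong)
  finally show ?thesis using T by simp
qed

section \<open>Leading terms\<close>

text \<open>Leading terms multiply: indices above the tops of the two factors cannot contribute, so only one
  pair of indices produces the degree \<open>N + M\<close>.\<close>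

lemma graded_ext_top:
  assumes u: "\<And>i. i > N \<Longrightarrow> lk u i = 0" and v: "\<And>i. i > M \<Longrightarrow> lk v i = 0"
  shows "lk (graded_ext c u v) (N + M) = c N M * lk u N * lk v M"
    and "i > N + M \<Longrightarrow> lk (graded_ext c u v) i = 0"
proof -
  let ?S = "insert N (Poly_Mapping.keys u)" and ?T = "insert M (Poly_Mapping.keys v)"
  have le: "n \<le> N" "m \<le> M" if "n \<in> ?S" "m \<in> ?T" for n m
    using that u v by (auto simp: in_keys_iff) (meson not_le)+
  have eq: "lk (graded_ext c u v) i = (\<Sum>n\<in>?S. \<Sum>m\<in>?T. if n + m = i
           then c n m * lk u n * lk v m else 0)" for i
    by (rule lookup_graded_ext) auto
  have "lk (graded_ext c u v) (N + M) = (\<Sum>n\<in>?S. if n = N then (\<Sum>m\<in>?T. if m = M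
           then c n m * lk u n * lk v m else 0) else 0)"
    unfolding eq
  proof (rule sum.cong[OF refl])
    fix n assume n: "n \<in> ?S"
    have "(if n + m = N + M then c n m * lk u n * lk v m else 0)
        = (if n = N then if m = M then c n m * lk u n * lk v m else 0 else 0)" if "m \<in> ?T" for m
      using le[OF n that] by auto
    then show "(\<Sum>m\<in>?T. if n + m = N + M then c n m * lk u n * lk v m else 0)
        = (if n = N then \<Sum>m\<in>?T. if m = M then c n m * lk u n * lk v m else 0 else 0)"
      by (cases "n = N") (auto intro!: sum.cong sum.neutral)
  qed
  then show "lk (graded_ext c u v) (N + M) = c N M * lk u N * lk v M" by simp
  show "lk (graded_ext c u v) i = 0" if "i > N + M"
    unfolding eq using le that by (intro sum.neutral ballI) fastforce
qed

lemma exists_top: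
  assumes "u \<noteq> 0"
  obtains N where "lk u N \<noteq> 0" "\<And>i. i > N \<Longrightarrow> lk u i = 0"
proof -
  have ne: "Poly_Mapping.keys u \<noteq> {}" using assms by simp
  let ?N = "Max (Poly_Mapping.keys u)"
  have "?N \<in> Poly_Mapping.keys u" using ne by (intro Max_in) auto
  moreover have "lk u i = 0" if "i > ?N" for i
    using Max_ge[of "Poly_Mapping.keys u" i] that by (meson finite_keys in_keys_iff not_le)
  ultimately show ?thesis using that by (auto simp: in_keys_iff)
qed

text \<open>If \<open>x\<close> lies in an abelian ideal, then \<open>[x, w]\<close> does, so \<open>ad x\<close> squares to zero. A nonzero
  \<open>x\<close> of top degree \<open>N\<close> violates this at \<open>w = L\<^sub>M\<close> with \<open>M > \<bar>N\<bar>\<close>: the leading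
  coefficient of \<open>[x, [x, w]]\<close> is the product of \<open>M (M - N)\<close> and a nonzero square.\<close>

lemma witt_no_abelian_ideal:
  assumes "\<And>w. witt_bracket x (witt_bracket x w) = 0"
  shows "x = 0"
proof (rule ccontr)
  assume "x \<noteq> 0"
  then obtain N where N: "lk x N \<noteq> 0" "\<And>i. i > N \<Longrightarrow> lk x i = 0" by (rule exists_top) blast
  define M where "M = \<bar>N\<bar> + 1"
  let ?w = "sg M 1"
  have w: "lk ?w i = 0" if "i > M" for i using that by (simp add: lookup_single)
  let ?y = "witt_bracket x ?w"
  have y: "lk ?y (N + M) = of_int (M - N) * lk x N" "\<And>i. i > N + M \<Longrightarrow> lk ?y i = 0"
    using graded_ext_top[of N x M ?w, OF N(2) w] by (auto simp: witt_bracket_def)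
  have "lk (witt_bracket x ?y) (N + (N + M)) = of_int M * lk x N * lk ?y (N + M)"
    using graded_ext_top(1)[of N x "N + M" ?y, OF N(2) y(2)] by (simp add: witt_bracket_def)
  moreover have "M \<noteq> 0" "M - N \<noteq> 0" by (auto simp: M_def)
  ultimately show False using assms[of ?w] N(1) y(1)
    by (metis lookup_zero mult_eq_0_iff of_int_eq_0_iff)
qed

section \<open>Homogeneous maps\<close>

text \<open>\<open>twist s c\<close> is the linear map that sends the \<open>n\<close>-th basis vector to \<open>c n\<close> times the
  \<open>s n\<close>-th one, for \<open>s\<close> equal to \<open>1\<close> or \<open>- 1\<close>. Since \<open>s\<close> is its own inverse, the
  coefficient of the image at \<open>i\<close> comes from the index \<open>s i\<close>. All homogeneous maps of this
  theory have this shape.\<close>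

definition twist :: "int \<Rightarrow> (int \<Rightarrow> complex) \<Rightarrow> (int \<Rightarrow>\<^sub>0 complex) \<Rightarrow> (int \<Rightarrow>\<^sub>0 complex)" where
  "twist s c u = Poly_Mapping.Abs_poly_mapping (\<lambda>i. c (s * i) * lk u (s * i))"

lemma lookup_twist [simp]:
  assumes "s = 1 \<or> s = - 1"
  shows "lk (twist s c u) i = c (s * i) * lk u (s * i)"
proof -
  have "(\<lambda>i. lk u i) \<in> C_inf" by (simp add: C_inf_def)
  then have "(\<lambda>i. c (s * i) * lk u (s * i)) \<in> C_inf"
    using C_inf_neg[of "lk u" s "\<lambda>i. c (s * i)"] assms by simp
  then show ?thesis by (simp add: twist_def C_inf_def)
qed

lemma linear_pm_twist: "s = 1 \<or> s = - 1 \<Longrightarrow> linear_pm (twist s c)"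
  by (rule linear_pmI) (auto intro!: poly_mapping_eqI simp: lookup_add algebra_simps)

lemma twist_single [simp]:
  "s = 1 \<or> s = - 1 \<Longrightarrow> twist s c (sg n a) = sg (s * n) (c n * a)"
  by (rule poly_mapping_eqI) (auto simp: lookup_single when_def)

lemma twist_twist:
  assumes "s = 1 \<or> s = - 1" "s' = 1 \<or> s' = - 1"
  shows "twist s c (twist s' c' u) = twist (s * s') (\<lambda>n. c (s' * n) * c' n) u"
proof -
  have "s * s' = 1 \<or> s * s' = - 1" using assms by auto
  then show ?thesis using assms by (intro poly_mapping_eqI) (auto simp: mult_ac)
qed

lemma bij_twist:
  assumes s: "s = 1 \<or> s = - 1" and c: "\<And>n. c n \<noteq> 0"
  shows "bij (twist s c)"
proof (rule o_bij)
  let ?g = "twist s (\<lambda>n. inverse (c (s * n)))"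
  have s2: "s * (s * i) = i" for i using s by auto
  show "?g \<circ> twist s c = id" "twist s c \<circ> ?g = id"
    using s c by (auto simp: fun_eq_iff s2 intro!: poly_mapping_eqI)
qed

section \<open>The structure constants of the modules\<close>

text \<open>These two rules would rewrite multiples of the basis vector number \<open>0\<close> to numerals, which the
  rules for basis vectors do not match.\<close>

declare single_one [simp del] single_of_int [simp del]

text \<open>With \<open>p\<close> the linear and \<open>q\<close> the quadratic part, \<open>L\<^sub>n A\<^sub>0 = n (p + q n) A\<^sub>n\<close> and
  \<open>L\<^sub>n B\<^bsub>-n\<^esub> = - n (p + q n) B\<^sub>0\<close>, so that the value \<open>\<infinity>\<close> of the parameter
  needs no separate treatment. The values \<open>0\<close> and \<open>- 1\<close> of \<open>\<lambda>\<close> are those with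
  \<open>q = 0\<close> and \<open>p = 0\<close>.\<close>

definition lin_part :: "proj_line \<Rightarrow> complex" where
  "lin_part l = (case l of Fin x \<Rightarrow> 1 + x | Infty \<Rightarrow> 1)"

definition quad_part :: "proj_line \<Rightarrow> complex" where
  "quad_part l = (case l of Fin x \<Rightarrow> x | Infty \<Rightarrow> 1)"

lemma mod_coeff_alt:
  "mod_coeff ModA l n m
     = (if m = 0 then of_int n * (lin_part l + quad_part l * of_int n) else of_int (n + m))"
  "mod_coeff ModB l n m
     = (if n + m = 0 then - (of_int n * (lin_part l + quad_part l * of_int n)) else of_int m)"
  by (cases l; auto simp: lin_part_def quad_part_def algebra_simps power2_eq_square add_eq_0_iff2)+

declare mod_coeff.simps [simp del]

lemma lin_quad_part_nonzero: "lin_part l \<noteq> 0 \<or> quad_part l \<noteq> 0"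
  by (cases l) (auto simp: lin_part_def quad_part_def)

lemma mod_coeff_L0 [simp]: "mod_coeff X l 0 m = of_int m"
  by (cases X) (auto simp: mod_coeff_alt)

lemma witt_bracket_single [simp]:
  "witt_bracket (sg n a) (sg m b) = sg (n + m) (of_int (m - n) * a * b)"
  by (simp add: witt_bracket_def)

lemma witt_act_single [simp]:
  "witt_act X l (sg n a) (sg m b) = sg (n + m) (mod_coeff X l n m * a * b)"
  by (simp add: witt_act_def)

lemma linear_pm_witt_bracket:
  "linear_pm (\<lambda>u. witt_bracket u v)" "linear_pm (witt_bracket u)"
  unfolding witt_bracket_def by (rule linear_pm_graded_ext)+

lemma linear_pm_witt_act:
  "linear_pm (\<lambda>u. witt_act X l u v)" "linear_pm (witt_act X l u)"
  unfolding witt_act_def by (rule linear_pm_graded_ext)+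

lemmas witt_act_add = linear_pmD(1)[OF linear_pm_witt_act(1)] linear_pmD(1)[OF linear_pm_witt_act(2)]

lemmas witt_linear_simps =
  witt_act_add linear_pmD(2)[OF linear_pm_witt_act(1)] linear_pmD(2)[OF linear_pm_witt_act(2)]
  linear_pmD(1,2)[OF linear_pm_witt_bracket(1)] linear_pmD(1,2)[OF linear_pm_witt_bracket(2)]

section \<open>Automorphisms of the Witt algebra and their lifts to the modules\<close>

definition witt_aut :: "int \<Rightarrow> complex \<Rightarrow> (int \<Rightarrow>\<^sub>0 complex) \<Rightarrow> (int \<Rightarrow>\<^sub>0 complex)" where
  "witt_aut s \<alpha> = twist s (\<lambda>n. of_int s * \<alpha> powi n)"

text \<open>The reflection \<open>L\<^sub>n \<mapsto> - L\<^bsub>-n\<^esub>\<close> turns \<open>(p, q)\<close> into \<open>(p, - q)\<close>. If \<open>q = 0\<close>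
  it therefore lifts to the module without any sign; if \<open>p = 0\<close> it lifts when the sign of the
  exceptional basis vector number \<open>0\<close> is changed.\<close>

definition zero_sign :: "proj_line \<Rightarrow> int \<Rightarrow> int \<Rightarrow> complex" where
  "zero_sign l s i = (if s = - 1 \<and> lin_part l = 0 \<and> i = 0 then - 1 else 1)"

definition mod_aut :: "proj_line \<Rightarrow> int \<Rightarrow> complex \<Rightarrow> complex \<Rightarrow> (int \<Rightarrow>\<^sub>0 complex) \<Rightarrow> (int \<Rightarrow>\<^sub>0 complex)" where
  "mod_aut l s \<alpha> \<xi> = twist s (\<lambda>n. zero_sign l s n * \<alpha> powi n * \<xi>)"

lemma bij_witt_aut: "s = 1 \<or> s = - 1 \<Longrightarrow> \<alpha> \<noteq> 0 \<Longrightarrow> bij (witt_aut s \<alpha>)"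
  unfolding witt_aut_def by (rule bij_twist) auto

lemma bij_mod_aut: "s = 1 \<or> s = - 1 \<Longrightarrow> \<alpha> \<noteq> 0 \<Longrightarrow> \<xi> \<noteq> 0 \<Longrightarrow> bij (mod_aut l s \<alpha> \<xi>)"
  unfolding mod_aut_def by (rule bij_twist) (auto simp: zero_sign_def)

lemma linear_pm_witt_aut: "s = 1 \<or> s = - 1 \<Longrightarrow> linear_pm (witt_aut s \<alpha>)"
  unfolding witt_aut_def by (rule linear_pm_twist)

lemma linear_pm_mod_aut: "s = 1 \<or> s = - 1 \<Longrightarrow> linear_pm (mod_aut l s \<alpha> \<xi>)"
  unfolding mod_aut_def by (rule linear_pm_twist)

lemma witt_aut_bracket:
  assumes s: "s = 1 \<or> s = - 1" and "\<alpha> \<noteq> 0"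
  shows "witt_aut s \<alpha> (witt_bracket u v) = witt_bracket (witt_aut s \<alpha> u) (witt_aut s \<alpha> v)"
proof (rule bilinear_pm_eqI[where F = "\<lambda>u v. witt_aut s \<alpha> (witt_bracket u v)"
      and G = "\<lambda>u v. witt_bracket (witt_aut s \<alpha> u) (witt_aut s \<alpha> v)"])
  show "witt_aut s \<alpha> (witt_bracket (sg n 1) (sg m 1))
      = witt_bracket (witt_aut s \<alpha> (sg n 1)) (witt_aut s \<alpha> (sg m 1))" for n m
    using assms by (auto simp: witt_aut_def power_int_add algebra_simps)
qed (simp_all add: linear_pm_def witt_linear_simps linear_pmD(1,2)[OF linear_pm_witt_aut[OF s]])

text \<open>On the indices where the coefficient is \<open>n + m\<close> or \<open>m\<close> the reflection is visibly compatible
  with the action. At the exceptional index one needs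
  \<open>p + q n = \<plusminus> (p - q n)\<close> for all \<open>n\<close>, which is possible exactly if \<open>p\<close> or
  \<open>q\<close> vanishes, with the sign recorded in \<open>zero_sign\<close>.\<close>

lemma mod_aut_act:
  assumes s: "s = 1 \<or> s = - 1" and "\<alpha> \<noteq> 0"
    and flip: "s = - 1 \<Longrightarrow> lin_part l * quad_part l = 0"
  shows "mod_aut l s \<alpha> \<xi> (witt_act X l u v) = witt_act X l (witt_aut s \<alpha> u) (mod_aut l s \<alpha> \<xi> v)"
proof (rule bilinear_pm_eqI[where F = "\<lambda>u v. mod_aut l s \<alpha> \<xi> (witt_act X l u v)"
      and G = "\<lambda>u v. witt_act X l (witt_aut s \<alpha> u) (mod_aut l s \<alpha> \<xi> v)"])
  fix n m
  have "mod_coeff X l n m * zero_sign l s (n + m)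
      = of_int s * mod_coeff X l (s * n) (s * m) * zero_sign l s m"
    using s
  proof
    assume "s = 1"
    then show ?thesis by (simp add: zero_sign_def)
  next
    assume [simp]: "s = - 1"
    have "lin_part l = 0 \<or> quad_part l = 0" using flip by simp
    then show ?thesis
      by (cases X) (auto simp: zero_sign_def mod_coeff_alt algebra_simps add_eq_0_iff2)
  qed
  then show "mod_aut l s \<alpha> \<xi> (witt_act X l (sg n 1) (sg m 1))
      = witt_act X l (witt_aut s \<alpha> (sg n 1)) (mod_aut l s \<alpha> \<xi> (sg m 1))"
    using s \<open>\<alpha> \<noteq> 0\<close> by (auto simp: witt_aut_def mod_aut_def power_int_add algebra_simps)
qed (simp_all add: linear_pm_def witt_linear_simps linear_pmD(1,2)[OF linear_pm_witt_aut[OF s]]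
    linear_pmD(1,2)[OF linear_pm_mod_aut[OF s]])

section \<open>Derivations from the Witt algebra to its modules\<close>

definition derivation :: "module_kind \<Rightarrow> proj_line \<Rightarrow> ((int \<Rightarrow>\<^sub>0 complex) \<Rightarrow> (int \<Rightarrow>\<^sub>0 complex)) \<Rightarrow> bool" where
  "derivation X l D \<longleftrightarrow> linear_pm D \<and>
     (\<forall>u v. D (witt_bracket u v) = witt_act X l u (D v) - witt_act X l v (D u))"

lemma derivation_inner: "derivation X l (\<lambda>u. witt_act X l u y)"
  by (simp add: derivation_def linear_pm_witt_act witt_act_bracket)

lemma derivation_add: "derivation X l D \<Longrightarrow> derivation X l E \<Longrightarrow> derivation X l (\<lambda>u. D u + E u)"
  by (simp add: derivation_def linear_pm_add witt_act_add)

lemma derivation_diff: "derivation X l D \<Longrightarrow> derivation X l E \<Longrightarrow> derivation X l (\<lambda>u. D u - E u)"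
  by (simp add: derivation_def linear_pm_diff linear_pmD(5)[OF linear_pm_witt_act(2)])

lemma derivation_diagonal:
  "derivation X l (twist 1 d) \<longleftrightarrow>
     (\<forall>n m. of_int (m - n) * d (n + m) = mod_coeff X l n m * d m - mod_coeff X l m n * d n)"
proof
  assume D: "derivation X l (twist 1 d)"
  show "\<forall>n m. of_int (m - n) * d (n + m) = mod_coeff X l n m * d m - mod_coeff X l m n * d n"
  proof (intro allI)
    fix n m
    have "twist 1 d (witt_bracket (sg n 1) (sg m 1))
       = witt_act X l (sg n 1) (twist 1 d (sg m 1)) - witt_act X l (sg m 1) (twist 1 d (sg n 1))"
      using D unfolding derivation_def by blast
    from arg_cong[OF this, of "\<lambda>w. lk w (n + m)"]
    show "of_int (m - n) * d (n + m) = mod_coeff X l n m * d m - mod_coeff X l m n * d n"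
      by (simp add: lookup_minus add.commute mult_ac)
  qed
next
  assume eq: "\<forall>n m. of_int (m - n) * d (n + m) = mod_coeff X l n m * d m - mod_coeff X l m n * d n"
  have "twist 1 d (witt_bracket u v) = witt_act X l u (twist 1 d v) - witt_act X l v (twist 1 d u)" for u v
  proof (rule bilinear_pm_eqI[where F = "\<lambda>u v. twist 1 d (witt_bracket u v)"
      and G = "\<lambda>u v. witt_act X l u (twist 1 d v) - witt_act X l v (twist 1 d u)"])
    fix n m
    show "twist 1 d (witt_bracket (sg n 1) (sg m 1))
       = witt_act X l (sg n 1) (twist 1 d (sg m 1)) - witt_act X l (sg m 1) (twist 1 d (sg n 1))"
      using eq[rule_format, of m n] by (simp add: single_diff[symmetric] add.commute mult_ac)
  qed (simp_all add: linear_pm_def witt_linear_simps linear_pmD(1,2)[OF linear_pm_twist])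
  then show "derivation X l (twist 1 d)"
    by (simp add: derivation_def linear_pm_twist)
qed

text \<open>The eigenvalues of the outer derivation that the reflection negates. On \<open>B(\<lambda>)\<close> the constant
  \<open>1\<close> satisfies the cocycle condition away from \<open>0\<close>; the pairs \<open>(n, - n)\<close> then dictate the
  value at \<open>0\<close>. The other candidate for an outer derivation, \<open>n \<mapsto> n\<close>, is the one that the
  reflection fixes.\<close>

definition outer :: "module_kind \<Rightarrow> proj_line \<Rightarrow> int \<Rightarrow> complex" where
  "outer X l n = (case X of ModA \<Rightarrow> (of_int n)\<^sup>2 | ModB \<Rightarrow> if n = 0 then lin_part l else 1)"

text \<open>On \<open>A(\<lambda>)\<close> the functions \<open>n\<close> and \<open>n\<^sup>2\<close> are always cocycles. On
  \<open>B(\<lambda>)\<close> the function \<open>n\<close> violates the condition for \<open>(n, - n)\<close> by a multiple of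
  \<open>q n\<^sup>2\<close>.\<close>

lemma derivation_outer:
  assumes "X = ModB \<Longrightarrow> b = 0 \<or> quad_part l = 0"
  shows "derivation X l (twist 1 (\<lambda>n. a * outer X l n + b * of_int n))"
  unfolding derivation_diagonal
proof (intro allI)
  fix n m :: int
  show "of_int (m - n) * (a * outer X l (n + m) + b * of_int (n + m))
     = mod_coeff X l n m * (a * outer X l m + b * of_int m)
       - mod_coeff X l m n * (a * outer X l n + b * of_int n)"
  proof (cases X)
    case ModA
    then show ?thesis
      by (auto simp: outer_def mod_coeff_alt algebra_simps power2_eq_square)
  next
    case ModB
    then have "b = 0 \<or> quad_part l = 0" using assms by simp
    then show ?thesis using ModB
      by (auto simp: outer_def mod_coeff_alt algebra_simps add_eq_0_iff2)
  qed
qed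

section \<open>The parametrised family of automorphisms\<close>

lemma witt_aut_witt_aut:
  assumes s: "s = 1 \<or> s = - 1" "s' = 1 \<or> s' = - 1"
  shows "witt_aut s \<alpha> (witt_aut s' \<beta> u) = witt_aut (s * s') (\<alpha> powi s' * \<beta>) u"
proof -
  have "\<alpha> powi (s' * n) = (\<alpha> powi s') powi n" for n by (rule power_int_mult)
  then show ?thesis
    by (simp add: witt_aut_def twist_twist[OF s] power_int_mult_distrib mult_ac)
qed

lemma mod_aut_mod_aut:
  assumes s: "s = 1 \<or> s = - 1" "s' = 1 \<or> s' = - 1"
  shows "mod_aut l s \<alpha> \<xi> (mod_aut l s' \<beta> \<zeta> v) = mod_aut l (s * s') (\<alpha> powi s' * \<beta>) (\<xi> * \<zeta>) v"
proof -
  have "zero_sign l s (s' * n) * zero_sign l s' n = zero_sign l (s * s') n" for n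
    using s by (auto simp: zero_sign_def)
  moreover have "\<alpha> powi (s' * n) = (\<alpha> powi s') powi n" for n by (rule power_int_mult)
  ultimately have "(\<lambda>n. zero_sign l s (s' * n) * \<alpha> powi (s' * n) * \<xi> * (zero_sign l s' n * \<beta> powi n * \<zeta>))
      = (\<lambda>n. zero_sign l (s * s') n * (\<alpha> powi s' * \<beta>) powi n * (\<xi> * \<zeta>))"
    by (simp add: fun_eq_iff power_int_mult_distrib mult_ac)
  then show ?thesis by (simp add: mod_aut_def twist_twist[OF s])
qed

lemma zero_sign_mult: "s = 1 \<or> s = - 1 \<Longrightarrow> zero_sign l s (s * i) = zero_sign l s i"
  by (auto simp: zero_sign_def)

text \<open>Conjugating an outer derivation by \<open>mod_aut\<close> and \<open>witt_aut\<close> scales it by \<open>\<xi>\<close> and, for the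
  reflection, negates the part along \<open>outer\<close> while fixing the part along \<open>n\<close>. The sign at index
  \<open>0\<close> does no harm because \<open>outer\<close> vanishes there whenever that sign is \<open>- 1\<close>.\<close>

lemma mod_aut_diagonal:
  assumes s: "s = 1 \<or> s = - 1" and s': "s' = 1 \<or> s' = - 1"
  shows "mod_aut l s \<alpha> \<xi> (twist 1 (\<lambda>n. of_int s' * a * outer X l n + b * of_int n) u)
    = twist 1 (\<lambda>n. \<xi> * (of_int (s * s') * a * outer X l n + b * of_int n)) (witt_aut s \<alpha> u)"
proof -
  have "zero_sign l s n * \<alpha> powi n * \<xi> * (of_int s' * a * outer X l n + b * of_int n)
     = \<xi> * (of_int (s * s') * a * outer X l (s * n) + b * of_int (s * n)) * (of_int s * \<alpha> powi n)" for n
    using s by (cases X) (auto simp: zero_sign_def outer_def algebra_simps)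
  then have "twist s (\<lambda>n. zero_sign l s n * \<alpha> powi n * \<xi> * (of_int s' * a * outer X l n + b * of_int n)) u
     = twist s (\<lambda>n. \<xi> * (of_int (s * s') * a * outer X l (s * n) + b * of_int (s * n)) * (of_int s * \<alpha> powi n)) u"
    by (simp only:)
  then show ?thesis using s by (simp add: mod_aut_def witt_aut_def twist_twist)
qed

type_synonym aut_param = "(int \<Rightarrow> complex) \<times> int \<times> complex \<times> complex \<times> complex \<times> complex"

text \<open>The tuple \<open>(y, k, a, b, \<alpha>, \<xi>)\<close> stands for the product, in this order, of the inner
  automorphism \<open>u \<mapsto> u + u y\<close>, the \<open>k\<close>-th power of the reflection, the map
  \<open>u \<mapsto> u + D u\<close> for the outer derivation \<open>D\<close> with coordinates \<open>a\<close> and \<open>b\<close>, the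
  rescaling of degree \<open>n\<close> by \<open>\<alpha>\<^sup>n\<close>, and the multiplication of the module by \<open>\<xi>\<close>.
  Moving the outer derivation to the left past the reflection produces the factor \<open>eps k\<close> in front
  of \<open>a\<close>.\<close>

definition param_aut :: "module_kind \<Rightarrow> proj_line \<Rightarrow> aut_param \<Rightarrow> witt_sum \<Rightarrow> witt_sum" where
  "param_aut X l = (\<lambda>(y, k, a, b, \<alpha>, \<xi>) (u, v).
     (witt_aut (eps k) \<alpha> u,
      mod_aut l (eps k) \<alpha> \<xi> v + witt_act X l (witt_aut (eps k) \<alpha> u) (Poly_Mapping.Abs_poly_mapping y)
      + twist 1 (\<lambda>n. of_int (eps k) * a * outer X l n + b * of_int n) (witt_aut (eps k) \<alpha> u)))"

definition param_mult :: "proj_line \<Rightarrow> aut_param \<Rightarrow> aut_param \<Rightarrow> aut_param" where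
  "param_mult l = (\<lambda>(y, k, a, b, \<alpha>, \<xi>) (z, h, c, d, \<beta>, \<zeta>).
     (\<lambda>i. y i + zero_sign l (eps k) i * \<alpha> powi (eps k * i) * \<xi> * z (eps k * i),
      k \<otimes>\<^bsub>Z2\<^esub> h, of_int (eps h) * a + \<xi> * c, b + \<xi> * d, \<alpha> powi eps h * \<beta>, \<xi> * \<zeta>))"

text \<open>Representatives without redundancy. The invariant \<open>B\<^sub>0\<close> acts as zero, hence the normalisation
  \<open>y 0 = 0\<close>. On \<open>A(\<lambda>)\<close> the combination \<open>p n + q n\<^sup>2\<close> is inner, given by
  \<open>A\<^sub>0\<close>, so one outer coordinate suffices: \<open>n\<^sup>2\<close> is a complement if \<open>p \<noteq> 0\<close>, and
  \<open>n\<close> is one if \<open>p = 0\<close>.\<close>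

definition params :: "module_kind \<Rightarrow> proj_line \<Rightarrow> aut_param set" where
  "params X l = {(y, k, a, b, \<alpha>, \<xi>). y \<in> C_inf \<and> (X = ModB \<longrightarrow> y 0 = 0) \<and> k \<in> carrier Z2
     \<and> (k = 1 \<longrightarrow> lin_part l * quad_part l = 0)
     \<and> (X = ModA \<longrightarrow> (if lin_part l = 0 then a = 0 else b = 0))
     \<and> (X = ModB \<longrightarrow> quad_part l \<noteq> 0 \<longrightarrow> b = 0) \<and> \<alpha> \<noteq> 0 \<and> \<xi> \<noteq> 0}"

lemma eps_mult: "k \<in> carrier Z2 \<Longrightarrow> h \<in> carrier Z2 \<Longrightarrow> eps (k \<otimes>\<^bsub>Z2\<^esub> h) = eps k * eps h"
  using eps_cases[of k] eps_cases[of h] by (auto simp: mult_integer_mod_group eps_def)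

lemma eps_flip: "k \<in> carrier Z2 \<Longrightarrow> eps k = - 1 \<longleftrightarrow> k = 1"
  using eps_cases[of k] by auto

lemma param_aut_mult:
  assumes "x \<in> params X l" "x' \<in> params X l"
  shows "param_aut X l (param_mult l x x') = param_aut X l x \<circ> param_aut X l x'"
proof
  fix w :: witt_sum
  obtain u v where w: "w = (u, v)" by (cases w)
  obtain y k a b \<alpha> \<xi> where x: "x = (y, k, a, b, \<alpha>, \<xi>)" by (metis prod_cases6)
  obtain z h c d \<beta> \<zeta> where x': "x' = (z, h, c, d, \<beta>, \<zeta>)" by (metis prod_cases6)
  let ?s = "eps k" and ?t = "eps h"
  have y: "y \<in> C_inf" "z \<in> C_inf" and nz: "\<alpha> \<noteq> 0" "\<beta> \<noteq> 0"
    and kh: "k \<in> carrier Z2" "h \<in> carrier Z2"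
    and k1: "k = 1 \<Longrightarrow> lin_part l * quad_part l = 0"
    using assms by (simp_all add: params_def x x')
  have s: "?s = 1 \<or> ?s = - 1" and t: "?t = 1 \<or> ?t = - 1"
    using kh by (simp_all add: eps_pm)
  have flip: "lin_part l * quad_part l = 0" if "?s = - 1"
    using k1 that eps_flip[OF kh(1)] by simp
  let ?Y = "Poly_Mapping.Abs_poly_mapping y" and ?Z = "Poly_Mapping.Abs_poly_mapping z"
  have lk: "lk ?Y i = y i" "lk ?Z i = z i" for i using y by (simp_all add: C_inf_def)
  define r where "r = (\<lambda>i. y i + zero_sign l ?s i * \<alpha> powi (?s * i) * \<xi> * z (?s * i))"
  have "r \<in> C_inf" unfolding r_def by (rule C_inf_comb[OF y s])
  then have r: "Poly_Mapping.Abs_poly_mapping r = ?Y + mod_aut l ?s \<alpha> \<xi> ?Z"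
    by (intro poly_mapping_eqI) (simp add: C_inf_def lookup_add lk mod_aut_def s zero_sign_mult[OF s], simp add: r_def)
  let ?u = "witt_aut ?s \<alpha> (witt_aut ?t \<beta> u)"
  have u: "witt_aut (?s * ?t) (\<alpha> powi ?t * \<beta>) u = ?u"
    using witt_aut_witt_aut[OF s t] by simp
  have diag: "twist 1 (\<lambda>n. of_int (?s * ?t) * (of_int ?t * a + \<xi> * c) * outer X l n + (b + \<xi> * d) * of_int n) ?u
    = twist 1 (\<lambda>n. of_int ?s * a * outer X l n + b * of_int n) ?u
      + mod_aut l ?s \<alpha> \<xi> (twist 1 (\<lambda>n. of_int ?t * c * outer X l n + d * of_int n) (witt_aut ?t \<beta> u))"
    unfolding mod_aut_diagonal[OF s t]
    by (rule poly_mapping_eqI) (use t in \<open>auto simp: lookup_add algebra_simps\<close>)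
  show "param_aut X l (param_mult l x x') w = (param_aut X l x \<circ> param_aut X l x') w"
    by (simp add: param_aut_def param_mult_def x x' w eps_mult[OF kh] u r[unfolded r_def] diag
        linear_pmD(1)[OF linear_pm_mod_aut[OF s]] mod_aut_act[OF s nz(1) flip] mod_aut_mod_aut[OF s t]
        witt_act_add del: of_int_mult mult_integer_mod_group)
qed

lemma carrier_Aut_W_iff:
  "f \<in> carrier (Aut_W X l) \<longleftrightarrow> bij f \<and> (\<forall>x y. f (x + y) = f x + f y)
     \<and> (\<forall>c x. f (witt_sum_scale c x) = witt_sum_scale c (f x))
     \<and> (\<forall>x y. f (witt_sum_bracket X l x y) = witt_sum_bracket X l (f x) (f y))"
  using lie_algebra.axioms(1)[OF lie_algebra_witt_sum]
  by (auto simp: Aut_W_def lie_aut_group_def Vector_Spaces.linear_iff)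

text \<open>Equivariance of \<open>\<phi>\<close> and the derivation property of \<open>D\<close> are precisely the two components of
  the homomorphism condition that involve the module; bijectivity is inherited from the diagonal.\<close>

lemma triangular_aut:
  assumes \<sigma>: "bij \<sigma>" "linear_pm \<sigma>" "\<And>u v. \<sigma> (witt_bracket u v) = witt_bracket (\<sigma> u) (\<sigma> v)"
    and \<phi>: "bij \<phi>" "linear_pm \<phi>" "\<And>u v. \<phi> (witt_act X l u v) = witt_act X l (\<sigma> u) (\<phi> v)"
    and D: "derivation X l D"
  shows "(\<lambda>(u, v). (\<sigma> u, \<phi> v + D (\<sigma> u))) \<in> carrier (Aut_W X l)"
proof -
  let ?f = "\<lambda>(u, v). (\<sigma> u, \<phi> v + D (\<sigma> u))"
  let ?g = "\<lambda>(u, v). (inv_into UNIV \<sigma> u, inv_into UNIV \<phi> (v - D u))"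
  have lin: "linear_pm D" using D by (simp add: derivation_def)
  have bij: "bij ?f"
    by (rule o_bij[of ?g]) (use \<sigma>(1) \<phi>(1) in \<open>auto simp: fun_eq_iff bij_is_inj bij_is_surj surj_f_inv_f\<close>)
  have "witt_act X l u (v - w) = witt_act X l u v - witt_act X l u w" for u v w
    by (rule linear_pmD(5)[OF linear_pm_witt_act(2)])
  then show ?thesis
    unfolding carrier_Aut_W_iff using bij D
    by (auto simp: linear_pmD(1,2)[OF \<sigma>(2)] linear_pmD(1,2)[OF \<phi>(2)] linear_pmD(5)[OF \<phi>(2)] linear_pmD(1,2)[OF lin]
        witt_sum_scale_def witt_sum_bracket_def \<sigma>(3) \<phi>(3) derivation_def witt_act_add)
qed

lemma param_aut_in_Aut:
  assumes "x \<in> params X l"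
  shows "param_aut X l x \<in> carrier (Aut_W X l)"
proof -
  obtain y k a b \<alpha> \<xi> where x: "x = (y, k, a, b, \<alpha>, \<xi>)" by (metis prod_cases6)
  let ?s = "eps k"
  have s: "?s = 1 \<or> ?s = - 1" and nz: "\<alpha> \<noteq> 0" "\<xi> \<noteq> 0"
    and flip: "?s = - 1 \<Longrightarrow> lin_part l * quad_part l = 0"
    and b: "X = ModB \<Longrightarrow> b = 0 \<or> quad_part l = 0"
    using assms eps_pm[of k] by (auto simp: params_def x eps_flip)
  let ?D = "\<lambda>u. witt_act X l u (Poly_Mapping.Abs_poly_mapping y)
      + twist 1 (\<lambda>n. of_int ?s * a * outer X l n + b * of_int n) u"
  have "derivation X l ?D"
    by (intro derivation_add derivation_inner derivation_outer b)
  then have "(\<lambda>(u, v). (witt_aut ?s \<alpha> u, mod_aut l ?s \<alpha> \<xi> v + ?D (witt_aut ?s \<alpha> u))) \<in> carrier (Aut_W X l)"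
    using s nz flip
    by (intro triangular_aut bij_witt_aut bij_mod_aut linear_pm_witt_aut linear_pm_mod_aut
        witt_aut_bracket mod_aut_act)
  then show ?thesis by (simp add: param_aut_def x add.assoc)
qed

lemma mod_coeff_0_right:
  "mod_coeff X l n 0 = (case X of ModA \<Rightarrow> of_int n * (lin_part l + quad_part l * of_int n) | ModB \<Rightarrow> 0)"
  by (cases X) (auto simp: mod_coeff_alt)

text \<open>The images of \<open>L\<^sub>1\<close> and \<open>X\<^sub>1\<close> determine \<open>k\<close>, \<open>\<alpha>\<close> and \<open>\<xi>\<close>. Then the
  derivation is determined; its value at \<open>L\<^sub>0\<close> gives \<open>y i\<close> for \<open>i \<noteq> 0\<close>, and its values
  at \<open>L\<^sub>1\<close> and \<open>L\<^bsub>-1\<^esub>\<close> separate the odd and the even part of the degree zero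
  component, which give \<open>y 0\<close>, \<open>a\<close> and \<open>b\<close>.\<close>

lemma inj_param_aut: "inj_on (param_aut X l) (params X l)"
proof (rule inj_onI)
  fix x x' assume xp: "x \<in> params X l" "x' \<in> params X l" and eq: "param_aut X l x = param_aut X l x'"
  obtain y k a b \<alpha> \<xi> where x: "x = (y, k, a, b, \<alpha>, \<xi>)" by (metis prod_cases6)
  obtain z h c d \<beta> \<zeta> where x': "x' = (z, h, c, d, \<beta>, \<zeta>)" by (metis prod_cases6)
  let ?s = "eps k" and ?t = "eps h"
  have s: "?s = 1 \<or> ?s = - 1" and t: "?t = 1 \<or> ?t = - 1"
    and y: "y \<in> C_inf" "z \<in> C_inf" and nz: "\<alpha> \<noteq> 0" "\<beta> \<noteq> 0" "\<xi> \<noteq> 0" "\<zeta> \<noteq> 0"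
    and kh: "k \<in> carrier Z2" "h \<in> carrier Z2"
    using xp eps_pm[of k] eps_pm[of h] by (auto simp: params_def x x')
  have ly: "lk (Poly_Mapping.Abs_poly_mapping y) i = y i" "lk (Poly_Mapping.Abs_poly_mapping z) i = z i" for i
    using y by (simp_all add: C_inf_def)
  have "fst (param_aut X l x (sg 1 1, 0)) = fst (param_aut X l x' (sg 1 1, 0))" by (simp add: eq)
  then have "sg ?s (of_int ?s * \<alpha>) = sg ?t (of_int ?t * \<beta>)"
    using s t by (simp add: param_aut_def x x' witt_aut_def)
  from arg_cong[OF this, of "\<lambda>w. lk w ?s"]
  have st: "?s = ?t \<and> \<alpha> = \<beta>"
    using nz s t by (auto simp: lookup_single when_def split: if_splits)
  then have kheq: "k = h" "\<beta> = \<alpha>" using eps_cases[OF kh(1)] eps_cases[OF kh(2)] by auto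
  have "snd (param_aut X l x (0, sg 1 1)) = snd (param_aut X l x' (0, sg 1 1))" by (simp add: eq)
  then have "sg ?s (\<alpha> * \<xi>) = sg ?s (\<alpha> * \<zeta>)"
    using s by (simp add: param_aut_def x x' mod_aut_def witt_aut_def kheq zero_sign_def
        linear_pmD(3)[OF linear_pm_twist] linear_pmD(3)[OF linear_pm_witt_act(1)])
  from arg_cong[OF this, of "\<lambda>w. lk w ?s"] have \<xi>: "\<zeta> = \<xi>" using nz by simp
  define D where "D = (\<lambda>y a b u. witt_act X l u (Poly_Mapping.Abs_poly_mapping y)
      + twist 1 (\<lambda>n. of_int ?s * a * outer X l n + b * of_int n) u)"
  have "D y a b u = D z c d u" for u
  proof -
    obtain u' where u: "u = witt_aut ?s \<alpha> u'"
      using bij_witt_aut[OF s nz(1)] by (meson bij_pointE)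
    have "snd (param_aut X l x (u', 0)) = snd (param_aut X l x' (u', 0))" by (simp add: eq)
    then show ?thesis by (simp add: param_aut_def x x' kheq \<xi> u D_def add.assoc)
  qed
  then have "lk (D y a b (sg n 1)) i = lk (D z c d (sg n 1)) i" for n i by simp
  then have D: "mod_coeff X l n (i - n) * y (i - n) + lk (sg n (of_int ?s * a * outer X l n + b * of_int n)) i
     = mod_coeff X l n (i - n) * z (i - n) + lk (sg n (of_int ?s * c * outer X l n + d * of_int n)) i" for n i
    by (simp add: D_def lookup_add ly witt_act_def lookup_graded_ext_single_left)
  have yz: "y i = z i" if "i \<noteq> 0" for i
    using D[of 0 i] that by (simp add: lookup_single)
  have D1: "mod_coeff X l n 0 * y 0 + (of_int ?s * a * outer X l n + b * of_int n)
     = mod_coeff X l n 0 * z 0 + (of_int ?s * c * outer X l n + d * of_int n)" for n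
    using D[of n n] by simp
  let ?e = "complex_of_int ?s"
  have "y 0 = z 0 \<and> a = c \<and> b = d"
  proof (cases X)
    case ModA
    have ab: "if lin_part l = 0 then a = 0 \<and> c = 0 else b = 0 \<and> d = 0"
      using xp ModA by (auto simp: params_def x x')
    have plus: "(lin_part l + quad_part l) * y 0 + (?e * a + b) = (lin_part l + quad_part l) * z 0 + (?e * c + d)"
      using D1[of 1] ModA by (simp add: mod_coeff_0_right outer_def)
    have minus: "- (lin_part l - quad_part l) * y 0 + (?e * a - b) = - (lin_part l - quad_part l) * z 0 + (?e * c - d)"
      using D1[of "- 1"] ModA by (simp add: mod_coeff_0_right outer_def)
    have "2 * (lin_part l * y 0 + b) = 2 * (lin_part l * z 0 + d)"
      using arg_cong2[OF plus minus, of "(-)"] by (simp add: algebra_simps)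
    then have lin: "lin_part l * y 0 + b = lin_part l * z 0 + d"
      by (simp only: mult_cancel_left) simp
    have "2 * (quad_part l * y 0 + ?e * a) = 2 * (quad_part l * z 0 + ?e * c)"
      using arg_cong2[OF plus minus, of "(+)"] by (simp add: algebra_simps)
    then have quad: "quad_part l * y 0 + ?e * a = quad_part l * z 0 + ?e * c"
      by (simp only: mult_cancel_left) simp
    have e: "?e \<noteq> 0" using s by auto
    show ?thesis
      using ab lin quad e lin_quad_part_nonzero[of l] by (cases "lin_part l = 0") auto
  next
    case ModB
    have "y 0 = 0" "z 0 = 0" using xp ModB by (auto simp: params_def x x')
    then have plus: "?e * a + b = ?e * c + d" and minus: "?e * a - b = ?e * c - d"
      using D1[of 1] D1[of "- 1"] ModB by (simp_all add: mod_coeff_0_right outer_def)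
    have "2 * b = 2 * d" using arg_cong2[OF plus minus, of "(-)"] by simp
    then have "b = d" by simp
    moreover have "?e \<noteq> 0" using s by auto
    ultimately show ?thesis using plus \<open>y 0 = 0\<close> \<open>z 0 = 0\<close> by simp
  qed
  then show "x = x'" using yz by (auto simp: x x' kheq \<xi>) (metis ext)
qed

section \<open>Classification of the derivations\<close>

lemma quadratic_recurrence_zero:
  fixes H :: "int \<Rightarrow> complex"
  assumes rec: "\<And>n m. of_int (m - n) * H (n + m) = of_int (n + m) * (H m - H n)"
    and "H 1 = 0" "H (- 1) = 0"
  shows "H (int k) = 0"
proof -
  have H0: "H 0 = 0" using rec[of 1 0] by simp
  have H2: "H 2 = 0" using rec[of 2 "- 1"] assms(2,3) by simp
  have "H (int k + 2) = 0" for k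
  proof (induction k)
    case (Suc k)
    have "of_int (- int k - 1) * H (int k + 3) = 0"
      using rec[of "int k + 2" 1] Suc \<open>H 1 = 0\<close> by (simp add: add_ac del: of_int_add of_int_diff of_int_minus)
    moreover have "complex_of_int (- int k - 1) \<noteq> 0" by (simp only: of_int_eq_0_iff)
    ultimately have "H (int k + 3) = 0" by (simp only: mult_eq_0_iff simp_thms)
    then show ?case by (simp add: add_ac)
  qed (use H2 in simp)
  then show ?thesis
    using H0 \<open>H 1 = 0\<close> by (cases k; cases "k - 1") (auto simp: add_ac)
qed

text \<open>Both \<open>n\<close> and \<open>n\<^sup>2\<close> solve the recurrence, and a solution is determined by its values at
  \<open>1\<close> and \<open>- 1\<close>.\<close>

lemma quadratic_recurrence:
  fixes G :: "int \<Rightarrow> complex"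
  assumes rec: "\<And>n m. of_int (m - n) * G (n + m) = of_int (n + m) * (G m - G n)"
  obtains \<beta> \<gamma> where "\<And>n. G n = \<beta> * of_int n + \<gamma> * (of_int n)\<^sup>2"
proof -
  define \<beta> where "\<beta> = (G 1 - G (- 1)) / 2"
  define \<gamma> where "\<gamma> = (G 1 + G (- 1)) / 2"
  define H where "H = (\<lambda>n. G n - \<beta> * of_int n - \<gamma> * (of_int n)\<^sup>2)"
  have "of_int (m - n) * H (n + m) = of_int (n + m) * (H m - H n)" for n m
  proof -
    have "of_int (m - n) * H (n + m) = of_int (m - n) * G (n + m)
        - of_int (m - n) * (\<beta> * of_int (n + m) + \<gamma> * (of_int (n + m))\<^sup>2)"
      by (simp add: H_def algebra_simps)
    also have "\<dots> = of_int (n + m) * (H m - H n)"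
      unfolding rec by (simp add: H_def algebra_simps power2_eq_square)
    finally show ?thesis .
  qed
  note H = this
  have H1: "H 1 = 0" "H (- 1) = 0" by (auto simp: H_def \<beta>_def \<gamma>_def field_simps)
  have pos: "H (int k) = 0" for k
    by (rule quadratic_recurrence_zero[OF H H1])
  have neg: "H (- int k) = 0" for k
  proof (rule quadratic_recurrence_zero[where H = "\<lambda>n. H (- n)"])
    show "of_int (m - n) * H (- (n + m)) = of_int (n + m) * (H (- m) - H (- n))" for n m
      using H[of "- m" "- n"] by (simp add: algebra_simps)
  qed (use H1 in simp_all)
  have "H n = 0" for n
    using pos[of "nat n"] neg[of "nat (- n)"] by (cases "n \<ge> 0") auto
  then show ?thesis by (intro that[of \<beta> \<gamma>]) (simp add: H_def algebra_simps)
qed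

text \<open>\<open>L\<^sub>0\<close> acts on the \<open>i\<close>-th basis vector as \<open>i\<close>, so subtracting an inner derivation
  removes from the value at \<open>L\<^sub>0\<close> all components but the one of degree \<open>0\<close>. Applying the
  derivation to \<open>[L\<^sub>0, L\<^sub>n] = n L\<^sub>n\<close> then shows that what is left preserves degrees.\<close>

lemma derivation_inner_plus_diagonal:
  assumes "derivation X l D"
  obtains Y d where "lk Y 0 = 0" "\<And>u. D u = witt_act X l u Y + twist 1 d u"
proof -
  \<comment> \<open>The inner derivation of \<open>Y\<close> takes the value \<open>\<Sum>i. i Y\<^sub>i X\<^sub>i\<close> at \<open>L\<^sub>0\<close>, whence the division by \<open>i\<close>.\<close>
  define w where "w = D (sg 0 1)"
  define Y where "Y = twist 1 (\<lambda>i. if i = 0 then 0 else inverse (of_int i)) w"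
  define E where "E = (\<lambda>u. D u - witt_act X l u Y)"
  have E: "derivation X l E"
    unfolding E_def by (intro derivation_diff assms derivation_inner)
  have E0: "E (sg 0 1) = sg 0 (lk w 0)"
    by (rule poly_mapping_eqI)
      (auto simp: E_def Y_def lookup_minus witt_act_def lookup_graded_ext_single_left w_def lookup_single)
  have "lk (E (sg n 1)) i = 0" if "i \<noteq> n" for n i
  proof -
    have "E (witt_bracket (sg 0 1) (sg n 1)) = witt_act X l (sg 0 1) (E (sg n 1)) - witt_act X l (sg n 1) (E (sg 0 1))"
      using E unfolding derivation_def by blast
    moreover have "E (witt_bracket (sg 0 1) (sg n 1)) = smul (of_int n) (E (sg n 1))"
      using E linear_pmD(2)[of E "of_int n" "sg n 1"] by (simp add: derivation_def)
    ultimately have "smul (of_int n) (E (sg n 1)) = witt_act X l (sg 0 1) (E (sg n 1)) - sg n (mod_coeff X l n 0 * lk w 0)"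
      by (simp add: E0)
    from arg_cong[OF this, of "\<lambda>w. lk w i"] show ?thesis
      using that by (simp add: lookup_minus witt_act_def lookup_graded_ext_single_left lookup_single)
  qed
  then have Es: "E (sg n 1) = sg n (lk (E (sg n 1)) n)" for n
    by (intro poly_mapping_eqI) (auto simp: lookup_single when_def)
  let ?d = "\<lambda>n. lk (E (sg n 1)) n"
  have "E u = twist 1 ?d u" for u
    by (rule linear_pm_eqI) (use E Es in \<open>auto simp: derivation_def linear_pm_twist\<close>)
  then have "D u = witt_act X l u Y + twist 1 ?d u" for u
    unfolding E_def by (metis add.commute diff_add_cancel)
  moreover have "lk Y 0 = 0" by (simp add: Y_def)
  ultimately show ?thesis using that by blast
qed

text \<open>The eigenvalues of a diagonal derivation satisfy the recurrence above: directly for \<open>A(\<lambda>)\<close>, and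
  after multiplication by \<open>n\<close> for \<open>B(\<lambda>)\<close>. In the latter case the pairs \<open>(n, - n)\<close> fix
  the eigenvalue at \<open>0\<close> and leave room for \<open>n\<close> only if \<open>q = 0\<close>.\<close>

lemma derivation_classification:
  assumes D: "derivation X l D"
  obtains Y a b where "\<And>u. D u = witt_act X l u Y + twist 1 (\<lambda>n. a * outer X l n + b * of_int n) u"
    "X = ModA \<longrightarrow> (if lin_part l = 0 then a = 0 else b = 0)"
    "X = ModB \<longrightarrow> lk Y 0 = 0 \<and> (quad_part l \<noteq> 0 \<longrightarrow> b = 0)"
proof -
  obtain Y d where Y: "lk Y 0 = 0" "\<And>u. D u = witt_act X l u Y + twist 1 d u"
    using derivation_inner_plus_diagonal[OF D] by blast
  have "derivation X l (\<lambda>u. D u - witt_act X l u Y)"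
    by (intro derivation_diff D derivation_inner)
  then have d: "of_int (m - n) * d (n + m) = mod_coeff X l n m * d m - mod_coeff X l m n * d n" for n m
    using derivation_diagonal[of X l d] by (simp add: Y(2))
  show ?thesis
  proof (cases X)
    case ModA
    have "of_int n * (lin_part l + quad_part l * of_int n) * d 0 = 0" for n
      using d[of 0 n] by (cases "n = 0") (auto simp: mod_coeff_alt ModA)
    from this[of 1] this[of "- 1"] have d0: "d 0 = 0"
      using lin_quad_part_nonzero[of l] by auto
    have "of_int (m - n) * d (n + m) = of_int (n + m) * (d m - d n)" for n m
      using d[of m n] by (cases "n = 0"; cases "m = 0") (auto simp: mod_coeff_alt ModA d0 algebra_simps)
    then obtain \<beta> \<gamma> where bg: "\<And>n. d n = \<beta> * of_int n + \<gamma> * (of_int n)\<^sup>2"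
      using quadratic_recurrence[of d] by blast
    \<comment> \<open>The inner derivation of \<open>A\<^sub>0\<close> has eigenvalues \<open>p n + q n\<^sup>2\<close>; \<open>y\<close> times it
      absorbs the \<open>n\<close> term if \<open>p \<noteq> 0\<close>, and the \<open>n\<^sup>2\<close> term otherwise.\<close>
    define y a b where "y = (if lin_part l = 0 then \<gamma> / quad_part l else \<beta> / lin_part l)"
      and "a = (if lin_part l = 0 then 0 else \<gamma> - y * quad_part l)"
      and "b = (if lin_part l = 0 then \<beta> else 0)"
    have "twist 1 d u = witt_act X l u (sg 0 y) + twist 1 (\<lambda>n. a * outer X l n + b * of_int n) u" for u
    proof (rule linear_pm_eqI[where F = "twist 1 d"
          and G = "\<lambda>u. witt_act X l u (sg 0 y) + twist 1 (\<lambda>n. a * outer X l n + b * of_int n) u"])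
      fix n
      have "d n = mod_coeff X l n 0 * y + (a * outer X l n + b * of_int n)"
        using lin_quad_part_nonzero[of l]
        by (auto simp: bg ModA mod_coeff_0_right outer_def y_def a_def b_def field_simps power2_eq_square)
      then show "twist 1 d (sg n 1) = witt_act X l (sg n 1) (sg 0 y)
          + twist 1 (\<lambda>n. a * outer X l n + b * of_int n) (sg n 1)"
        by (simp add: single_add[symmetric])
    qed (intro linear_pm_add linear_pm_witt_act linear_pm_twist; simp)+
    then have "D u = witt_act X l u (Y + sg 0 y) + twist 1 (\<lambda>n. a * outer X l n + b * of_int n) u" for u
      by (simp add: Y(2) witt_act_add add_ac)
    moreover have "if lin_part l = 0 then a = 0 else b = 0" by (simp add: a_def b_def)
    ultimately show ?thesis using that[of "Y + sg 0 y" a b] ModA by blast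
  next
    case ModB
    have "of_int (m - n) * (of_int (n + m) * d (n + m)) = of_int (n + m) * (of_int m * d m - of_int n * d n)" for n m
    proof (cases "n + m = 0")
      case False
      then have "of_int (m - n) * d (n + m) = of_int m * d m - of_int n * d n"
        using d[of m n] by (simp add: mod_coeff_alt ModB add.commute)
      then show ?thesis by (metis mult.left_commute)
    qed simp
    then obtain \<beta> \<gamma> where "\<And>n. of_int n * d n = \<beta> * of_int n + \<gamma> * (of_int n)\<^sup>2"
      using quadratic_recurrence[of "\<lambda>n. of_int n * d n"] by blast
    then have "of_int n * d n = of_int n * (\<beta> + \<gamma> * of_int n)" for n
      by (simp add: algebra_simps power2_eq_square)
    then have bg: "d n = \<beta> + \<gamma> * of_int n" if "n \<noteq> 0" for n
      using that by (metis mult_left_cancel of_int_eq_0_iff)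
    have "2 * (d 0 - lin_part l * \<beta>) = - 2 * quad_part l * \<gamma> * (of_int n)\<^sup>2" if "n \<noteq> 0" for n
    proof -
      have "of_int n * (2 * (d 0 - lin_part l * \<beta>)) = of_int n * (- 2 * quad_part l * \<gamma> * (of_int n)\<^sup>2)"
        using d[of n "- n"] that by (simp add: mod_coeff_alt ModB bg power2_eq_square) (simp add: algebra_simps)
      then show ?thesis using that by (metis mult_left_cancel of_int_eq_0_iff)
    qed
    from this[of 1] this[of 2] have "quad_part l * \<gamma> = 0" and d0: "d 0 = lin_part l * \<beta>" by auto
    then have "d = (\<lambda>n. \<beta> * outer X l n + \<gamma> * of_int n)"
      using bg by (auto simp: fun_eq_iff ModB outer_def)
    then show ?thesis using that[of Y \<beta> \<gamma>] Y ModB \<open>quad_part l * \<gamma> = 0\<close> by auto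
  qed
qed

section \<open>Classification of the automorphisms of the Witt algebra\<close>

text \<open>Suppose the image \<open>x\<close> of \<open>L\<^sub>0\<close> had top degree \<open>N > 0\<close>. The image \<open>w\<close> of
  \<open>L\<^sub>n\<close>, with top degree \<open>M\<close>, is an eigenvector of \<open>ad x\<close>, so the leading term of
  \<open>[x, w]\<close>, which is \<open>M - N\<close> times a nonzero vector of degree \<open>N + M\<close>, must vanish. Hence
  \<open>M = N\<close> for every \<open>n\<close>, and the map could not reach \<open>L\<^bsub>N+1\<^esub>\<close>.\<close>

lemma witt_aut_L0_top:
  assumes "bij \<sigma>" and lin: "linear_pm \<sigma>"
    and hom: "\<And>u v. \<sigma> (witt_bracket u v) = witt_bracket (\<sigma> u) (\<sigma> v)"
    and "i > 0"
  shows "lk (\<sigma> (sg 0 1)) i = 0"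
proof (rule ccontr)
  have inj: "u = 0" if "\<sigma> u = 0" for u
    using that linear_pmD(3)[OF lin] \<open>bij \<sigma>\<close> by (metis bij_pointE)
  let ?x = "\<sigma> (sg 0 1)"
  assume *: "lk ?x i \<noteq> 0"
  then have "?x \<noteq> 0" by auto
  then obtain N where N: "lk ?x N \<noteq> 0" "\<And>j. j > N \<Longrightarrow> lk ?x j = 0" by (rule exists_top) blast
  have "N \<ge> i" using N(2) * by force
  then have "N > 0" using \<open>i > 0\<close> by simp
  have "lk (\<sigma> (sg n 1)) j = 0" if "j > N" for n j
  proof -
    let ?w = "\<sigma> (sg n 1)"
    have "sg n (1::complex) \<noteq> 0" by (metis lookup_single_eq lookup_zero one_neq_zero)
    then have "?w \<noteq> 0" using inj by blast
    then obtain M where M: "lk ?w M \<noteq> 0" "\<And>j. j > M \<Longrightarrow> lk ?w j = 0" by (rule exists_top) blast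
    have "witt_bracket ?x ?w = smul (of_int n) ?w"
      using hom[of "sg 0 1" "sg n 1"] linear_pmD(2)[OF lin, of "of_int n" "sg n 1"] by simp
    from arg_cong[OF this, of "\<lambda>w. lk w (N + M)"]
    have "of_int (M - N) * lk ?x N * lk ?w M = of_int n * lk ?w (N + M)"
      using graded_ext_top(1)[OF N(2) M(2), where c = "\<lambda>n m. of_int (m - n)"] by (simp add: witt_bracket_def)
    then have "M = N" using N(1) M \<open>N > 0\<close> by auto
    then show ?thesis using M(2) that by blast
  qed
  then have "lk (\<sigma> u) (N + 1) = 0" for u
  proof (induction u rule: basis_induct)
    case (single n a)
    show ?case using single unfolding sg_smul[of n a] linear_pmD(2)[OF lin] by simp
  qed (simp_all add: linear_pmD(1,3)[OF lin] lookup_add)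
  moreover obtain u where "sg (N + 1) 1 = \<sigma> u" using \<open>bij \<sigma>\<close> by (meson bij_pointE)
  ultimately show False by (metis lookup_single_eq one_neq_zero)
qed

text \<open>The law is not assumed for \<open>n = m\<close>, since \<open>[L\<^sub>n, L\<^sub>n] = 0\<close> carries no information.
  The missing value is recovered from \<open>h 1 = h 2 * h (- 1)\<close>.\<close>

lemma power_law:
  fixes h :: "int \<Rightarrow> complex"
  assumes mult: "\<And>n m. n \<noteq> m \<Longrightarrow> h (n + m) = h n * h m" and h0: "h 0 = 1"
  shows "h 1 \<noteq> 0" "h n = h 1 powi n"
proof -
  have inv: "h 1 * h (- 1) = 1" using mult[of 1 "- 1"] h0 by simp
  then show nz: "h 1 \<noteq> 0" by auto
  have "h 1 = h 2 * h (- 1)" using mult[of 2 "- 1"] by simp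
  then have "h 1 * h 1 = h 2" using inv by (metis mult.assoc mult.commute mult.right_neutral)
  then have step: "h (n + 1) = h n * h 1" for n using mult[of n 1] by (cases "n = 1") auto
  show "h n = h 1 powi n"
  proof (induction n rule: int_induct[where k = 0])
    case (step1 i)
    then show ?case by (simp add: step power_int_add nz)
  next
    case (step2 i)
    then show ?case using step[of "i - 1"] nz by (simp add: power_int_diff field_simps)
  qed (use h0 in simp)
qed

text \<open>By the previous argument, applied also after the reflection, the image of \<open>L\<^sub>0\<close> is
  \<open>c L\<^sub>0\<close>. The map then permutes the weight spaces: \<open>L\<^sub>n\<close> goes to a multiple of
  \<open>L\<^bsub>sn\<^esub>\<close> with \<open>c s = 1\<close>, and surjectivity forces \<open>s = \<plusminus> 1\<close>.\<close>

lemma witt_aut_classification: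
  assumes bij: "bij \<sigma>" and lin: "linear_pm \<sigma>"
    and hom: "\<And>u v. \<sigma> (witt_bracket u v) = witt_bracket (\<sigma> u) (\<sigma> v)"
  obtains s \<alpha> where "s = 1 \<or> s = - 1" "\<alpha> \<noteq> 0" "\<sigma> = witt_aut s \<alpha>"
proof -
  have inj: "u = 0" if "\<sigma> u = 0" for u
    using that linear_pmD(3)[OF lin] bij by (metis bij_pointE)
  have nz: "\<sigma> (sg n 1) \<noteq> 0" for n
    using inj by (metis lookup_single_eq lookup_zero one_neq_zero)
  let ?flip = "witt_aut (- 1) 1"
  have up: "lk (\<sigma> (sg 0 1)) i = 0" if "i > 0" for i
    using witt_aut_L0_top[OF bij lin hom that] .
  have "lk (?flip (\<sigma> (sg 0 1))) i = 0" if "i > 0" for i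
  proof (rule witt_aut_L0_top[where \<sigma> = "\<lambda>u. ?flip (\<sigma> u)"])
    show "bij (\<lambda>u. ?flip (\<sigma> u))"
      using bij_comp[OF bij bij_witt_aut[of "- 1" 1]] by (simp add: comp_def)
  qed (use that in \<open>simp_all add: linear_pm_comp linear_pm_witt_aut lin hom witt_aut_bracket\<close>)
  from this[of "- i" for i] have down: "lk (\<sigma> (sg 0 1)) i = 0" if "i < 0" for i
    using that by (simp add: witt_aut_def)
  define c where "c = lk (\<sigma> (sg 0 1)) 0"
  have x: "\<sigma> (sg 0 1) = sg 0 c"
    by (rule poly_mapping_eqI) (use up down in \<open>auto simp: c_def lookup_single when_def linorder_neq_iff\<close>)
  have ev: "c * of_int i * lk (\<sigma> (sg n 1)) i = of_int n * lk (\<sigma> (sg n 1)) i" for n i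
  proof -
    have "witt_bracket (sg 0 c) (\<sigma> (sg n 1)) = smul (of_int n) (\<sigma> (sg n 1))"
      using hom[of "sg 0 1" "sg n 1"] linear_pmD(2)[OF lin, of "of_int n" "sg n 1"] x by simp
    from arg_cong[OF this, of "\<lambda>w. lk w i"] show ?thesis
      by (simp add: witt_bracket_def lookup_graded_ext_single_left mult.commute[of c])
  qed
  obtain s where s: "lk (\<sigma> (sg 1 1)) s \<noteq> 0"
    using nz[of 1] by (metis lookup_zero poly_mapping_eqI)
  have cs: "c * of_int s = 1" using ev[of s 1] s by simp
  have supp: "i = s * n" if "lk (\<sigma> (sg n 1)) i \<noteq> 0" for n i
  proof -
    have "c * of_int i = of_int n" using ev[of i n] that by simp
    then have "complex_of_int i = of_int s * of_int n"
      using cs by (metis mult.assoc mult.commute mult.left_neutral)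
    then show ?thesis by (metis of_int_eq_iff of_int_mult)
  qed
  have "lk (\<sigma> u) i = 0" if "\<not> s dvd i" for u i
  proof (induction u rule: basis_induct)
    case (single n a)
    have "lk (\<sigma> (sg n 1)) i = 0" using supp[of n i] that by (metis dvd_triv_left)
    then show ?case unfolding sg_smul[of n a] linear_pmD(2)[OF lin] by simp
  qed (simp_all add: linear_pmD(1,3)[OF lin] lookup_add)
  moreover obtain u where "sg 1 1 = \<sigma> u" using bij by (meson bij_pointE)
  ultimately have "s dvd 1" by (metis lookup_single_eq one_neq_zero)
  then have s1: "s = 1 \<or> s = - 1" by auto
  then have cs: "c = of_int s" using cs by (auto simp: equation_minus_iff[of c])
  define h where "h = (\<lambda>n. of_int s * lk (\<sigma> (sg n 1)) (s * n))"
  have ss: "of_int s * (of_int s * z) = (z::complex)" for z using s1 by auto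
  have \<sigma>: "\<sigma> (sg n 1) = sg (s * n) (of_int s * h n)" for n
    by (rule poly_mapping_eqI) (use supp[of n] in \<open>auto simp: h_def ss lookup_single when_def\<close>)
  have h0: "h 0 = 1" using x s1 by (auto simp: h_def cs)
  have mult: "h (n + m) = h n * h m" if "n \<noteq> m" for n m
  proof -
    have "\<sigma> (sg (n + m) (of_int (m - n))) = \<sigma> (witt_bracket (sg n 1) (sg m 1))" by simp
    also have "\<dots> = witt_bracket (sg (s * n) (of_int s * h n)) (sg (s * m) (of_int s * h m))"
      unfolding hom \<sigma> ..
    also have "\<sigma> (sg (n + m) (of_int (m - n))) = smul (of_int (m - n)) (sg (s * (n + m)) (of_int s * h (n + m)))"
      unfolding sg_smul[of "n + m" "of_int (m - n)"] linear_pmD(2)[OF lin] \<sigma> ..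
    finally have "sg (s * (n + m)) (of_int (m - n) * (of_int s * h (n + m)))
        = sg (s * n + s * m) (of_int (s * m - s * n) * (of_int s * h n) * (of_int s * h m))" by simp
    from arg_cong[OF this, of "\<lambda>w. lk w (s * (n + m))"]
    have "of_int (m - n) * (of_int s * h (n + m)) = of_int (m - n) * (of_int s * (h n * h m))"
      using s1 by (auto simp: algebra_simps lookup_single)
    then show ?thesis using that s1 by auto
  qed
  have "\<sigma> u = witt_aut s (h 1) u" for u
  proof (rule linear_pm_eqI[OF lin linear_pm_witt_aut[OF s1]])
    fix n
    have "h n = h 1 powi n" by (rule power_law(2)[OF mult h0])
    then show "\<sigma> (sg n 1) = witt_aut s (h 1) (sg n 1)"
      using s1 by (simp add: \<sigma> witt_aut_def)
  qed
  then show ?thesis using that[OF s1 power_law(1)[OF mult h0]] by blast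
qed

section \<open>Classification of the lifts to the modules\<close>

lemma lin_quad_comparison:
  fixes p q :: complex
  assumes "(p + q) * x = (p + t * q) * y" "(p - q) * x = (p - t * q) * y"
  shows "p * x = p * y" "q * x = t * q * y"
proof -
  have "2 * (p * x) = 2 * (p * y)"
    using arg_cong2[OF assms, of "(+)"] by (simp add: algebra_simps)
  then show "p * x = p * y" by (simp only: mult_cancel_left) simp
  have "2 * (q * x) = 2 * (t * q * y)"
    using arg_cong2[OF assms, of "(-)"] by (simp add: algebra_simps)
  then show "q * x = t * q * y" by (simp only: mult_cancel_left) simp
qed

text \<open>Weights show that \<open>X\<^sub>m\<close> is sent to a multiple of \<open>X\<^bsub>sm\<^esub>\<close>. After division by
  \<open>\<alpha>\<^sup>m\<close> the coefficients agree for all nonzero \<open>m\<close>, because the action connects any two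
  nonzero indices. Index \<open>0\<close> is tied to the others only through the polynomial \<open>n (p + q n)\<close>,
  whose values at \<open>1\<close> and \<open>- 1\<close> determine the last coefficient.\<close>

lemma mod_aut_classification:
  assumes s: "s = 1 \<or> s = - 1" and \<alpha>: "\<alpha> \<noteq> 0" and bij: "bij \<phi>" and lin: "linear_pm \<phi>"
    and hom: "\<And>u v. \<phi> (witt_act X l u v) = witt_act X l (witt_aut s \<alpha> u) (\<phi> v)"
  obtains \<xi> where "\<xi> \<noteq> 0" "\<phi> = mod_aut l s \<alpha> \<xi>" "s = - 1 \<Longrightarrow> lin_part l * quad_part l = 0"
proof -
  have inj: "u = 0" if "\<phi> u = 0" for u
    using that linear_pmD(3)[OF lin] bij by (metis bij_pointE)
  have nz: "\<phi> (sg n 1) \<noteq> 0" for n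
    using inj by (metis lookup_single_eq lookup_zero one_neq_zero)
  have ss: "s * (s * i) = i" for i using s by auto
  have supp: "i = s * m" if "lk (\<phi> (sg m 1)) i \<noteq> 0" for m i
  proof -
    have "smul (of_int m) (\<phi> (sg m 1)) = witt_act X l (sg 0 (of_int s)) (\<phi> (sg m 1))"
      using hom[of "sg 0 1" "sg m 1"] linear_pmD(2)[OF lin, of "of_int m" "sg m 1"] s
      by (simp add: witt_aut_def)
    from arg_cong[OF this, of "\<lambda>w. lk w i"] have "complex_of_int m = of_int (i * s)"
      using that by (simp add: witt_act_def lookup_graded_ext_single_left)
    then have "m = i * s" by (metis of_int_eq_iff)
    then show ?thesis using ss[of i] by (simp add: mult.commute)
  qed
  define e where "e = (\<lambda>m. lk (\<phi> (sg m 1)) (s * m) / \<alpha> powi m)"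
  have \<phi>: "\<phi> (sg m 1) = sg (s * m) (\<alpha> powi m * e m)" for m
    by (rule poly_mapping_eqI) (use supp[of m] \<alpha> in \<open>auto simp: e_def lookup_single when_def\<close>)
  have e_nz: "e m \<noteq> 0" for m using nz[of m] unfolding \<phi> by auto
  have rec: "mod_coeff X l n m * e (n + m) = of_int s * mod_coeff X l (s * n) (s * m) * e m" for n m
  proof -
    have "\<phi> (sg (n + m) (mod_coeff X l n m)) = \<phi> (witt_act X l (sg n 1) (sg m 1))" by simp
    also have "\<dots> = witt_act X l (sg (s * n) (of_int s * \<alpha> powi n)) (sg (s * m) (\<alpha> powi m * e m))"
      unfolding hom \<phi> using s by (simp add: witt_aut_def)
    also have "\<phi> (sg (n + m) (mod_coeff X l n m)) = smul (mod_coeff X l n m) (sg (s * (n + m)) (\<alpha> powi (n + m) * e (n + m)))"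
      unfolding sg_smul[of "n + m" "mod_coeff X l n m"] linear_pmD(2)[OF lin] \<phi> ..
    finally have "sg (s * (n + m)) (mod_coeff X l n m * (\<alpha> powi (n + m) * e (n + m)))
        = sg (s * n + s * m) (mod_coeff X l (s * n) (s * m) * (of_int s * \<alpha> powi n) * (\<alpha> powi m * e m))" by simp
    from arg_cong[OF this, of "\<lambda>w. lk w (s * n + s * m)"]
    have "\<alpha> powi (n + m) * (mod_coeff X l n m * e (n + m))
       = \<alpha> powi (n + m) * (of_int s * mod_coeff X l (s * n) (s * m) * e m)"
      using \<alpha> by (simp add: algebra_simps power_int_add)
    then show ?thesis using \<alpha> by simp
  qed
  have nonzero: "e m = e 1" if "m \<noteq> 0" for m
    using rec[of "m - 1" 1] that s by (cases X) (auto simp: mod_coeff_alt)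
  have zero: "lin_part l * e 0 = lin_part l * e 1 \<and> quad_part l * e 0 = of_int s * quad_part l * e 1"
  proof (cases X)
    case ModA
    have "(lin_part l + quad_part l) * e 1 = (lin_part l + of_int s * quad_part l) * e 0"
      using rec[of 1 0] s by (auto simp: mod_coeff_alt ModA)
    moreover have "(lin_part l - quad_part l) * e 1 = (lin_part l - of_int s * quad_part l) * e 0"
      using rec[of "- 1" 0] s nonzero[of "- 1"] by (auto simp: mod_coeff_alt ModA algebra_simps)
    ultimately have "lin_part l * e 1 = lin_part l * e 0" "quad_part l * e 1 = of_int s * quad_part l * e 0"
      by (rule lin_quad_comparison)+
    moreover have "of_int s * (of_int s * z) = z" for z :: complex using s by auto
    ultimately show ?thesis by (metis mult.assoc)
  next
    case ModB
    have "(lin_part l + quad_part l) * e 0 = (lin_part l + of_int s * quad_part l) * e 1"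
      using rec[of 1 "- 1"] s nonzero[of "- 1"] by (auto simp: mod_coeff_alt ModB algebra_simps)
    moreover have "(lin_part l - quad_part l) * e 0 = (lin_part l - of_int s * quad_part l) * e 1"
      using rec[of "- 1" 1] s by (auto simp: mod_coeff_alt ModB algebra_simps)
    ultimately have "lin_part l * e 0 = lin_part l * e 1" "quad_part l * e 0 = of_int s * quad_part l * e 1"
      by (rule lin_quad_comparison)+
    then show ?thesis by blast
  qed
  have "s = - 1 \<Longrightarrow> lin_part l * quad_part l = 0"
    using zero e_nz[of 1] by auto
  moreover have e: "e m = zero_sign l s m * e 1" for m
  proof (cases "m = 0")
    case True
    then show ?thesis
      using zero s lin_quad_part_nonzero[of l] by (auto simp: zero_sign_def)
  next
    case False
    then show ?thesis using nonzero[of m] by (simp add: zero_sign_def)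
  qed
  have "\<phi> u = mod_aut l s \<alpha> (e 1) u" for u
  proof (rule linear_pm_eqI[OF lin linear_pm_mod_aut[OF s]])
    fix n
    show "\<phi> (sg n 1) = mod_aut l s \<alpha> (e 1) (sg n 1)"
      using s unfolding \<phi> e[of n] by (simp add: mod_aut_def mult_ac)
  qed
  ultimately show ?thesis using that[of "e 1"] e_nz[of 1] by blast
qed

section \<open>Every automorphism belongs to the family\<close>

text \<open>The module is an abelian ideal, hence so is the projection of its image to the Witt algebra.\<close>

lemma aut_preserves_module:
  assumes "f \<in> carrier (Aut_W X l)"
  shows "fst (f (0, v)) = 0"
proof (rule witt_no_abelian_ideal)
  note f = assms[unfolded carrier_Aut_W_iff]
  fix w
  obtain t where t: "f t = (w, 0)" using f by (metis bij_pointE)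
  have zero: "witt_bracket 0 u = 0" "witt_bracket u 0 = 0" "witt_act X l 0 u = 0" for u
    by (simp_all add: witt_bracket_def witt_act_def)
  let ?b = "witt_sum_bracket X l"
  have "f 0 = 0" using f by (metis add_cancel_right_right)
  moreover have "?b (0, v) (?b (0, v) t) = 0"
    by (simp add: witt_sum_bracket_def zero zero_prod_def)
  ultimately have "?b (f (0, v)) (?b (f (0, v)) (w, 0)) = 0"
    using f t by metis
  then show "witt_bracket (fst (f (0, v))) (witt_bracket (fst (f (0, v))) w) = 0"
    by (simp add: witt_sum_bracket_def zero_prod_def)
qed

lemma Aut_W_surj:
  assumes fA: "f \<in> carrier (Aut_W X l)"
  shows "f \<in> param_aut X l ` params X l"
proof -
  interpret group "Aut_W X l" by (rule group_Aut_W)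
  note f = fA[unfolded carrier_Aut_W_iff]
  have f_bij: "bij f" and f_add: "f (x + y) = f x + f y"
    and f_scale: "f (witt_sum_scale c x) = witt_sum_scale c (f x)"
    and f_bracket: "f (witt_sum_bracket X l x y) = witt_sum_bracket X l (f x) (f y)" for x y c
    using f by blast+
  obtain g where gA: "g \<in> carrier (Aut_W X l)" and gf: "g (f x) = x" for x
  proof -
    have "(inv\<^bsub>Aut_W X l\<^esub> f) \<circ> f = id"
      using l_inv[OF fA] by (simp add: Aut_W_def lie_aut_group_def)
    then have "(inv\<^bsub>Aut_W X l\<^esub> f) (f x) = x" for x by (metis comp_apply id_apply)
    then show ?thesis using that inv_closed[OF fA] by blast
  qed
  have fM: "f (0, v) = (0, snd (f (0, v)))" for v
    using aut_preserves_module[OF fA, of v] by (simp add: prod_eq_iff)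
  define \<sigma> where "\<sigma> = (\<lambda>u. fst (f (u, 0)))"
  define \<phi> where "\<phi> = (\<lambda>v. snd (f (0, v)))"
  define E where "E = (\<lambda>u. snd (f (u, 0)))"
  have f_eq: "f (u, v) = (\<sigma> u, \<phi> v + E u)" for u v
  proof -
    have "f (u, v) = f (u, 0) + f (0, v)" by (simp add: f_add[symmetric])
    also have "\<dots> = (\<sigma> u, \<phi> v + E u)"
      by (subst fM) (simp add: \<sigma>_def \<phi>_def E_def prod_eq_iff add.commute)
    finally show ?thesis .
  qed
  have zero: "witt_bracket 0 u = 0" "witt_bracket u 0 = 0" "witt_act X l 0 u = 0" "witt_act X l u 0 = 0" for u
    by (simp_all add: witt_bracket_def witt_act_def)
  have lin: "linear_pm \<sigma>" "linear_pm \<phi>" "linear_pm E"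
    using f_add[of "(u, 0)" "(v, 0)" for u v] f_add[of "(0, u)" "(0, v)" for u v]
      f_scale[of c "(u, 0)" for c u] f_scale[of c "(0, u)" for c u]
    by (auto intro!: linear_pmI simp: \<sigma>_def \<phi>_def E_def witt_sum_scale_def)
  \<comment> \<open>If \<open>\<sigma> u = 0\<close>, then \<open>f (u, 0)\<close> lies in the module, which the inverse automorphism preserves.\<close>
  have \<sigma>0: "u = 0" if "\<sigma> u = 0" for u
  proof -
    have "f (u, 0) = (0, E u)" by (simp add: that f_eq linear_pmD(3)[OF lin(2)])
    then have "(u, 0) = g (0, E u)" by (metis gf)
    then show "u = 0" using aut_preserves_module[OF gA, of "E u"] by (metis fst_conv)
  qed
  have "inj \<sigma>"
    by (rule injI) (metis \<sigma>0 linear_pmD(5)[OF lin(1)] right_minus_eq)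
  moreover have "surj \<sigma>"
    by (rule surjI[of _ "\<lambda>w. fst (inv_into UNIV f (w, 0))"])
      (metis f_bij f_eq bij_is_surj surj_f_inv_f prod.collapse fst_conv)
  ultimately have \<sigma>_bij: "bij \<sigma>" by (simp add: bij_def)
  have "inj \<phi>"
  proof (rule injI)
    fix v w assume "\<phi> v = \<phi> w"
    then have "f (0, v) = f (0, w)" by (simp add: f_eq)
    then show "v = w" by (metis gf snd_conv)
  qed
  moreover have "surj \<phi>"
  proof (rule surjI)
    fix w
    obtain t where t: "f t = (0, w)" using f_bij by (metis bij_pointE)
    have "fst t = 0" using f_eq[of "fst t" "snd t"] t \<sigma>0 by simp
    then show "\<phi> (snd (inv_into UNIV f (0, w))) = w"
      using t f_bij by (metis \<phi>_def bij_is_inj inv_f_f prod.collapse snd_conv)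
  qed
  ultimately have \<phi>_bij: "bij \<phi>" by (simp add: bij_def)
  have \<sigma>_hom: "\<sigma> (witt_bracket u v) = witt_bracket (\<sigma> u) (\<sigma> v)"
    and E_der: "E (witt_bracket u v) = witt_act X l (\<sigma> u) (E v) - witt_act X l (\<sigma> v) (E u)" for u v
    using f_bracket[of "(u, 0)" "(v, 0)"]
    by (simp_all add: f_eq witt_sum_bracket_def zero linear_pmD(3)[OF lin(2)])
  have \<phi>_hom: "\<phi> (witt_act X l u v) = witt_act X l (\<sigma> u) (\<phi> v)" for u v
    using f_bracket[of "(u, 0)" "(0, v)"]
    by (simp add: f_eq witt_sum_bracket_def zero linear_pmD(3)[OF lin(1)] linear_pmD(3)[OF lin(2)] linear_pmD(3)[OF lin(3)])
  obtain s \<alpha> where s: "s = 1 \<or> s = - 1" and \<alpha>: "\<alpha> \<noteq> 0" and \<sigma>: "\<sigma> = witt_aut s \<alpha>"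
    using witt_aut_classification[OF \<sigma>_bij lin(1) \<sigma>_hom] by blast
  obtain \<xi> where \<xi>: "\<xi> \<noteq> 0" and \<phi>: "\<phi> = mod_aut l s \<alpha> \<xi>" and flip: "s = - 1 \<Longrightarrow> lin_part l * quad_part l = 0"
    using mod_aut_classification[OF s \<alpha> \<phi>_bij lin(2), of X l] \<phi>_hom \<sigma> by metis
  define D where "D = (\<lambda>u. E (inv_into UNIV \<sigma> u))"
  have inv: "inv_into UNIV \<sigma> (\<sigma> u) = u" "\<sigma> (inv_into UNIV \<sigma> u) = u" for u
    using \<sigma>_bij by (simp_all add: bij_is_inj bij_is_surj surj_f_inv_f)
  have ED: "E u = D (\<sigma> u)" for u by (simp add: D_def inv)
  \<comment> \<open>Since \<open>\<sigma>\<close> is onto, properties of \<open>D\<close> need only be checked on images under \<open>\<sigma>\<close>.\<close>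
  have D\<sigma>: "P u v" if "\<And>u v. P (\<sigma> u) (\<sigma> v)" for P u v
    using that by (metis inv(2))
  have "D (u + v) = D u + D v" for u v
    by (rule D\<sigma>[where P = "\<lambda>u v. D (u + v) = D u + D v"])
      (simp add: linear_pmD(1)[OF lin(1), symmetric] ED[symmetric] linear_pmD(1)[OF lin(3)])
  moreover have "D (smul c u) = smul c (D u)" for c u
    by (rule D\<sigma>[where P = "\<lambda>u v. D (smul c u) = smul c (D u)"])
      (simp add: linear_pmD(2)[OF lin(1), symmetric] ED[symmetric] linear_pmD(2)[OF lin(3)])
  moreover have "D (witt_bracket u v) = witt_act X l u (D v) - witt_act X l v (D u)" for u v
    by (rule D\<sigma>[where P = "\<lambda>u v. D (witt_bracket u v) = witt_act X l u (D v) - witt_act X l v (D u)"])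
      (simp add: \<sigma>_hom[symmetric] ED[symmetric] E_der)
  ultimately have "derivation X l D" by (auto simp: derivation_def linear_pm_def)
  then obtain Y a b where D: "\<And>u. D u = witt_act X l u Y + twist 1 (\<lambda>n. a * outer X l n + b * of_int n) u"
    and ab: "X = ModA \<longrightarrow> (if lin_part l = 0 then a = 0 else b = 0)"
    "X = ModB \<longrightarrow> lk Y 0 = 0 \<and> (quad_part l \<noteq> 0 \<longrightarrow> b = 0)"
    by (rule derivation_classification) blast
  define k where "k = (if s = 1 then 0 else 1 :: int)"
  have k: "k \<in> carrier Z2" "eps k = s" using s by (auto simp: k_def carrier_integer_mod_group eps_def)
  have a: "of_int s * (of_int s * a) = a" using s by auto
  \<comment> \<open>The factor \<open>s\<close> undoes the factor \<open>eps k\<close> in \<open>param_aut\<close>.\<close>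
  let ?x = "(lk Y, k, of_int s * a, b, \<alpha>, \<xi>)"
  have "?x \<in> params X l"
    using ab k(1) \<alpha> \<xi> flip s by (auto simp: params_def C_inf_def k_def split: if_splits)
  moreover have "f = param_aut X l ?x"
    by (rule ext) (auto simp: param_aut_def k(2) f_eq ED D \<sigma>[symmetric] \<phi>[symmetric] a
        Poly_Mapping.poly_mapping.lookup_inverse add.assoc)
  ultimately show ?thesis by blast
qed

section \<open>Identification with the explicit groups\<close>

lemma Aut_W_iso_params:
  assumes inj: "inj_on e (carrier G)" and img: "e ` carrier G = params X l"
    and mult: "\<And>p q. p \<in> carrier G \<Longrightarrow> q \<in> carrier G \<Longrightarrow> e (p \<otimes>\<^bsub>G\<^esub> q) = param_mult l (e p) (e q)"
    and "group G"
  shows "Aut_W X l \<cong> G"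
proof -
  interpret G: group G by fact
  have "bij_betw e (carrier G) (params X l)"
    using inj img by (simp add: bij_betw_def)
  moreover have "bij_betw (param_aut X l) (params X l) (carrier (Aut_W X l))"
    using param_aut_in_Aut Aut_W_surj inj_param_aut by (auto simp: bij_betw_def)
  ultimately have "bij_betw (param_aut X l \<circ> e) (carrier G) (carrier (Aut_W X l))"
    by (rule bij_betw_trans)
  moreover have "param_aut X l \<circ> e \<in> hom G (Aut_W X l)"
  proof (rule homI)
    fix p q assume pq: "p \<in> carrier G" "q \<in> carrier G"
    then have "e p \<in> params X l" "e q \<in> params X l" using img by auto
    then show "(param_aut X l \<circ> e) p \<in> carrier (Aut_W X l)"
      and "(param_aut X l \<circ> e) (p \<otimes>\<^bsub>G\<^esub> q) = (param_aut X l \<circ> e) p \<otimes>\<^bsub>Aut_W X l\<^esub> (param_aut X l \<circ> e) q"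
      using param_aut_in_Aut param_aut_mult mult[OF pq] by (auto simp: Aut_W_def lie_aut_group_def)
  qed
  ultimately have "G \<cong> Aut_W X l" by (intro is_isoI isoI)
  then show ?thesis by (rule G.iso_sym)
qed

lemma Z2_cases: "k \<in> carrier Z2 \<longleftrightarrow> k = 0 \<or> k = 1"
  by (auto simp: carrier_integer_mod_group)

lemma iso_A0: "Aut_W ModA (Fin 0) \<cong> grp_A0_Bm1 C_inf"
proof (rule Aut_W_iso_params)
  let ?e = "\<lambda>(y, k, a, \<alpha>, \<xi>). (y, k, a, 0, \<alpha>, \<xi>)"
  show "inj_on ?e (carrier (grp_A0_Bm1 C_inf))" by (auto simp: inj_on_def)
  show "?e ` carrier (grp_A0_Bm1 C_inf) = params ModA (Fin 0)"
    by (force simp: grp_A0_Bm1_def params_def Cx_def lin_part_def quad_part_def image_iff)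
  show "?e (p \<otimes>\<^bsub>grp_A0_Bm1 C_inf\<^esub> q) = param_mult (Fin 0) (?e p) (?e q)" for p q
    by (cases p; cases q) (simp add: grp_A0_Bm1_def param_mult_def zero_sign_def lin_part_def)
qed (simp add: group_grp_A0_Bm1)

lemma iso_Am1: "Aut_W ModA (Fin (- 1)) \<cong> grp_Am1"
proof (rule Aut_W_iso_params)
  let ?e = "\<lambda>(y, k, b, \<alpha>, \<xi>). (y, k, 0, b, \<alpha>, \<xi>)"
  show "inj_on ?e (carrier grp_Am1)" by (auto simp: inj_on_def)
  show "?e ` carrier grp_Am1 = params ModA (Fin (- 1))"
    by (force simp: grp_Am1_def params_def Cx_def lin_part_def quad_part_def image_iff)
  fix p q assume "p \<in> carrier grp_Am1" "q \<in> carrier grp_Am1"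
  then show "?e (p \<otimes>\<^bsub>grp_Am1\<^esub> q) = param_mult (Fin (- 1)) (?e p) (?e q)"
    by (cases p; cases q) (auto simp: grp_Am1_def param_mult_def zero_sign_def lin_part_def fun_eq_iff dest!: eps_cases)
qed (rule group_grp_Am1)

lemma iso_B0: "Aut_W ModB (Fin 0) \<cong> grp_B0"
proof (rule Aut_W_iso_params)
  show "inj_on id (carrier grp_B0)" by simp
  show "id ` carrier grp_B0 = params ModB (Fin 0)"
    by (auto simp: grp_B0_def params_def Cx_def C0_inf_def lin_part_def quad_part_def)
  show "id (p \<otimes>\<^bsub>grp_B0\<^esub> q) = param_mult (Fin 0) (id p) (id q)" for p q
    by (cases p; cases q) (simp add: grp_B0_def param_mult_def zero_sign_def lin_part_def)
qed (rule group_grp_B0)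

lemma iso_Bm1: "Aut_W ModB (Fin (- 1)) \<cong> grp_A0_Bm1 C0_inf"
proof (rule Aut_W_iso_params)
  let ?e = "\<lambda>(y, k, a, \<alpha>, \<xi>). (y, k, a, 0, \<alpha>, \<xi>)"
  show "inj_on ?e (carrier (grp_A0_Bm1 C0_inf))" by (auto simp: inj_on_def)
  show "?e ` carrier (grp_A0_Bm1 C0_inf) = params ModB (Fin (- 1))"
    by (force simp: grp_A0_Bm1_def params_def Cx_def C0_inf_def lin_part_def quad_part_def image_iff)
  fix p q assume "p \<in> carrier (grp_A0_Bm1 C0_inf)" "q \<in> carrier (grp_A0_Bm1 C0_inf)"
  then show "?e (p \<otimes>\<^bsub>grp_A0_Bm1 C0_inf\<^esub> q) = param_mult (Fin (- 1)) (?e p) (?e q)"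
    by (cases p; cases q) (auto simp: grp_A0_Bm1_def param_mult_def zero_sign_def C0_inf_def lin_part_def fun_eq_iff)
qed (simp add: group_grp_A0_Bm1)

lemma iso_generic:
  assumes "l \<notin> {Fin 0, Fin (- 1)}" and V: "V = (case X of ModA \<Rightarrow> C_inf | ModB \<Rightarrow> C0_inf)"
  shows "Aut_W X l \<cong> grp_generic V"
proof (rule Aut_W_iso_params)
  have nz: "lin_part l \<noteq> 0" "quad_part l \<noteq> 0"
    using assms(1) by (cases l; auto simp: lin_part_def quad_part_def add_eq_0_iff)+
  let ?e = "\<lambda>(y, a, \<alpha>, \<xi>). (y, 0, a, 0, \<alpha>, \<xi>)"
  show "inj_on ?e (carrier (grp_generic V))" by (auto simp: inj_on_def)
  show "?e ` carrier (grp_generic V) = params X l"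
    using nz V by (cases X; force simp: grp_generic_def params_def Cx_def C0_inf_def image_iff Z2_cases)
  show "?e (p \<otimes>\<^bsub>grp_generic V\<^esub> q) = param_mult l (?e p) (?e q)" for p q
    using nz by (cases p; cases q) (simp add: grp_generic_def param_mult_def zero_sign_def eps_def)
qed (use V in \<open>auto intro: group_grp_generic split: module_kind.splits\<close>)

theorem theorem1p2:
  fixes X :: module_kind and l :: proj_line
  shows
    "(X = ModA \<and> l = Fin 0 \<longrightarrow> Aut_W X l \<cong> grp_A0_Bm1 C_inf) \<and>
     (X = ModA \<and> l = Fin (- 1) \<longrightarrow> Aut_W X l \<cong> grp_Am1) \<and>
     (X = ModB \<and> l = Fin 0 \<longrightarrow> Aut_W X l \<cong> grp_B0) \<and>
     (X = ModB \<and> l = Fin (- 1) \<longrightarrow> Aut_W X l \<cong> grp_A0_Bm1 C0_inf) \<and>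
     (X = ModA \<and> l \<notin> {Fin 0, Fin (- 1)} \<longrightarrow> Aut_W X l \<cong> grp_generic C_inf) \<and>
     (X = ModB \<and> l \<notin> {Fin 0, Fin (- 1)} \<longrightarrow> Aut_W X l \<cong> grp_generic C0_inf)"
  using iso_A0 iso_Am1 iso_B0 iso_Bm1 iso_generic[of l C_inf ModA] iso_generic[of l C0_inf ModB] by auto

end
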